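(* There exists a minimally generated Boolean algebra $\mathfrak A$ such that its Stone space $K=\operatorname{ult}(\mathfrak A)$ is a separable Rosenthal compact space which is not weakly Radon-Nikod\'ym compact.
   Context: $\operatorname{ult}(\mathfrak A)$ denotes the Stone space (of ultrafilters) of a Boolean algebra $\mathfrak A$. Minimal extensions: if $\mathfrak B$ is a subalgebra of $\mathfrak A$ and $x\in\mathfrak A\setminus\mathfrak B$, let $\mathfrak B(x)$ be the subalgebra of $\mathfrak A$ generated by $\mathfrak B\cup\{x\}$. $\mathfrak B(x)$ is a minimal extension of $\mathfrak B$ if every algebra $\mathfrak C$ with $\mathfrak B\subseteq\mathfrak C\subseteq\mathfrak B(x)$ satisfies $\mathfrak C=\mathfrak B$ or $\mathfrak C=\mathfrak B(x)$. A Boolean algebra $\mathfrak A$ is minimally generated if, for some ordinal $\gamma$, $\mathfrak A=\bigcup_{\xi<\gamma}\mathfrak B_\xi$ is a continuous increasing union (i.e. $\mathfrak B_\eta=\bigcup_{\xi<\eta}\mathfrak B_\xi$ at limit $\eta$) of subalgebras where $\mathfrak B_0=\{0,1\}$ and each $\mathfrak B_{\xi+1}$ is a minimal extension of $\mathfrak B_\xi$. A compact space is Rosenthal compact if it can be embedded into $B_1(X)$, the space of real-valued Baire-one functions on a Polish space $X$ with the topology of pointwise convergence. A compact space is weakly Radon-Nikod\'ym (WRN) if it is homeomorphic to a weak*-compact subset of the dual of a Banach space not containing an isomorphic copy of $\ell_1$. *)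

theory Defs
  imports "HOL-Analysis.Analysis"
begin

section \<open>Minimally generated Boolean algebras\<close>

definition boolean_subalgebra :: "'a::boolean_algebra set \<Rightarrow> bool" where
  "boolean_subalgebra A \<longleftrightarrow>
     bot \<in> A \<and> top \<in> A \<and> (\<forall>a\<in>A. - a \<in> A) \<and> (\<forall>a\<in>A. \<forall>b\<in>A. inf a b \<in> A \<and> sup a b \<in> A)"

definition minimal_extension :: "'a::boolean_algebra set \<Rightarrow> 'a set \<Rightarrow> bool" where
  "minimal_extension B B' \<longleftrightarrow>
     boolean_subalgebra B \<and>
     (\<exists>x. x \<notin> B \<and> B' = boolean_subalgebra hull (insert x B)) \<and>
     (\<forall>C. boolean_subalgebra C \<and> B \<subseteq> C \<and> C \<subseteq> B' \<longrightarrow> C = B \<or> C = B')"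

text \<open>
  The ordinal length of the chain is represented by a well-order \<open>r\<close>, and
  \<open>underS r j = under r i\<close> says that \<open>j\<close> is the immediate successor of \<open>i\<close>. Taking \<open>r\<close> on the
  type \<open>'a\<close> of the elements of \<open>A\<close> is no restriction: the chain is strictly increasing, so its
  length has cardinality at most that of \<open>A\<close>.
\<close>

definition minimally_generated :: "'a::boolean_algebra set \<Rightarrow> bool" where
  "minimally_generated A \<longleftrightarrow>
     (\<exists>(r :: 'a rel) B.
        Well_order r \<and>
        A = (\<Union>i\<in>Field r. B i) \<and>
        (\<forall>i\<in>Field r. boolean_subalgebra (B i)) \<and>
        (\<forall>(i, j)\<in>r. B i \<subseteq> B j) \<and>
        (\<forall>j\<in>Field r. underS r j = {} \<longrightarrow> B j = {bot, top}) \<and>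
        (\<forall>i\<in>Field r. \<forall>j\<in>Field r. underS r j = under r i \<longrightarrow> minimal_extension (B i) (B j)) \<and>
        (\<forall>j\<in>Field r. underS r j \<noteq> {} \<and> (\<forall>i\<in>Field r. underS r j \<noteq> under r i)
            \<longrightarrow> B j = (\<Union>i\<in>underS r j. B i)))"


section \<open>The Stone space\<close>

definition ultrafilters :: "'a::boolean_algebra set \<Rightarrow> 'a set set" where
  "ultrafilters A =
     {U. U \<subseteq> A \<and> top \<in> U \<and> bot \<notin> U \<and>
         (\<forall>a\<in>U. \<forall>b\<in>U. inf a b \<in> U) \<and>
         (\<forall>a\<in>U. \<forall>b\<in>A. a \<le> b \<longrightarrow> b \<in> U) \<and>
         (\<forall>a\<in>A. a \<in> U \<or> - a \<in> U)}"

definition stone_space :: "'a::boolean_algebra set \<Rightarrow> 'a set topology" where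
  "stone_space A = topology_generated_by ((\<lambda>a. {U \<in> ultrafilters A. a \<in> U}) ` A)"


section \<open>Rosenthal compact spaces\<close>

definition polish_topology :: "'a topology \<Rightarrow> bool" where
  "polish_topology X \<longleftrightarrow> separable_space X \<and> completely_metrizable_space X"

text \<open>Functions on \<open>X\<close> are represented by their extensional versions, as in \<open>product_topology\<close>.\<close>

definition baire_one_space :: "'a topology \<Rightarrow> ('a \<Rightarrow> real) topology" where
  "baire_one_space X =
     subtopology (powertop_real (topspace X))
       {f. \<exists>g :: nat \<Rightarrow> 'a \<Rightarrow> real. (\<forall>n. continuous_map X euclideanreal (g n)) \<and>
                (\<forall>x\<in>topspace X. (\<lambda>n. g n x) \<longlonglongrightarrow> f x)}"

text \<open>
  Polish spaces have at most continuum many points, so up to homeomorphism every one of them has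
  an underlying set of reals (with a topology unrelated to that of the real line).
\<close>

definition rosenthal_compact :: "'a topology \<Rightarrow> bool" where
  "rosenthal_compact K \<longleftrightarrow>
     compact_space K \<and>
     (\<exists>(X :: real topology) f. polish_topology X \<and> embedding_map K (baire_one_space X) f)"


section \<open>Weakly Radon-Nikodym compact spaces\<close>

text \<open>
  Real Banach spaces with an explicit carrier, because the type class \<open>banach\<close> does not allow
  quantification over Banach spaces inside a formula.
\<close>

locale banach_space_on =
  fixes E :: "'e set"
    and add :: "'e \<Rightarrow> 'e \<Rightarrow> 'e"
    and zero :: 'e
    and scl :: "real \<Rightarrow> 'e \<Rightarrow> 'e"
    and nrm :: "'e \<Rightarrow> real"
  assumes zero_in: "zero \<in> E"
    and add_in: "\<lbrakk>x \<in> E; y \<in> E\<rbrakk> \<Longrightarrow> add x y \<in> E"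
    and scale_in: "x \<in> E \<Longrightarrow> scl c x \<in> E"
    and add_assoc: "\<lbrakk>x \<in> E; y \<in> E; z \<in> E\<rbrakk> \<Longrightarrow> add (add x y) z = add x (add y z)"
    and add_commute: "\<lbrakk>x \<in> E; y \<in> E\<rbrakk> \<Longrightarrow> add x y = add y x"
    and add_zero: "x \<in> E \<Longrightarrow> add x zero = x"
    and add_minus: "x \<in> E \<Longrightarrow> add x (scl (- 1) x) = zero"
    and scale_add_right: "\<lbrakk>x \<in> E; y \<in> E\<rbrakk> \<Longrightarrow> scl c (add x y) = add (scl c x) (scl c y)"
    and scale_add_left: "x \<in> E \<Longrightarrow> scl (c + d) x = add (scl c x) (scl d x)"
    and scale_scale: "x \<in> E \<Longrightarrow> scl c (scl d x) = scl (c * d) x"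
    and scale_one: "x \<in> E \<Longrightarrow> scl 1 x = x"
    and nrm_ge_zero: "x \<in> E \<Longrightarrow> 0 \<le> nrm x"
    and nrm_eq_zero: "x \<in> E \<Longrightarrow> nrm x = 0 \<longleftrightarrow> x = zero"
    and nrm_scale: "x \<in> E \<Longrightarrow> nrm (scl c x) = \<bar>c\<bar> * nrm x"
    and nrm_triangle: "\<lbrakk>x \<in> E; y \<in> E\<rbrakk> \<Longrightarrow> nrm (add x y) \<le> nrm x + nrm y"
    and complete:
      "\<lbrakk>\<And>n::nat. s n \<in> E;
        \<And>e. e > 0 \<Longrightarrow> \<exists>N. \<forall>m\<ge>N. \<forall>n\<ge>N. nrm (add (s m) (scl (- 1) (s n))) < e\<rbrakk>
       \<Longrightarrow> \<exists>l\<in>E. (\<lambda>n. nrm (add (s n) (scl (- 1) l))) \<longlonglongrightarrow> 0"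

lemma banach_space_on_UNIV: "banach_space_on (UNIV :: 'e::banach set) (+) 0 scaleR norm"
proof
  fix s :: "nat \<Rightarrow> 'e"
  assume "\<And>e. e > 0 \<Longrightarrow> \<exists>N. \<forall>m\<ge>N. \<forall>n\<ge>N. norm (s m + (- 1) *\<^sub>R s n) < e"
  hence "Cauchy s" by (simp add: Cauchy_def dist_norm)
  then obtain l where "s \<longlonglongrightarrow> l" by (auto simp: Cauchy_convergent_iff convergent_def)
  hence "(\<lambda>n. norm (s n + (- 1) *\<^sub>R l)) \<longlonglongrightarrow> 0" by (simp add: LIM_zero tendsto_norm_zero)
  thus "\<exists>l\<in>UNIV. (\<lambda>n. norm (s n + (- 1) *\<^sub>R l)) \<longlonglongrightarrow> 0" by blast
qed (simp_all add: algebra_simps norm_triangle_ineq)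

definition dual_on ::
    "'e set \<Rightarrow> ('e \<Rightarrow> 'e \<Rightarrow> 'e) \<Rightarrow> (real \<Rightarrow> 'e \<Rightarrow> 'e) \<Rightarrow> ('e \<Rightarrow> real) \<Rightarrow> ('e \<Rightarrow> real) set" where
  "dual_on E add scl nrm =
     {\<phi> \<in> extensional E.
        (\<forall>x\<in>E. \<forall>y\<in>E. \<phi> (add x y) = \<phi> x + \<phi> y) \<and>
        (\<forall>c. \<forall>x\<in>E. \<phi> (scl c x) = c * \<phi> x) \<and>
        (\<exists>M. \<forall>x\<in>E. \<bar>\<phi> x\<bar> \<le> M * nrm x)}"

definition weak_star_topology ::
    "'e set \<Rightarrow> ('e \<Rightarrow> 'e \<Rightarrow> 'e) \<Rightarrow> (real \<Rightarrow> 'e \<Rightarrow> 'e) \<Rightarrow> ('e \<Rightarrow> real) \<Rightarrow> ('e \<Rightarrow> real) topology" where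
  "weak_star_topology E add scl nrm = subtopology (powertop_real E) (dual_on E add scl nrm)"

definition l1_space :: "(nat \<Rightarrow> real) set" where
  "l1_space = {a. summable (\<lambda>n. \<bar>a n\<bar>)}"

definition contains_l1 ::
    "'e set \<Rightarrow> ('e \<Rightarrow> 'e \<Rightarrow> 'e) \<Rightarrow> (real \<Rightarrow> 'e \<Rightarrow> 'e) \<Rightarrow> ('e \<Rightarrow> real) \<Rightarrow> bool" where
  "contains_l1 E add scl nrm \<longleftrightarrow>
     (\<exists>T c C. c > 0 \<and> T ` l1_space \<subseteq> E \<and>
        (\<forall>a\<in>l1_space. \<forall>b\<in>l1_space. T (\<lambda>n. a n + b n) = add (T a) (T b)) \<and>
        (\<forall>t. \<forall>a\<in>l1_space. T (\<lambda>n. t * a n) = scl t (T a)) \<and>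
        (\<forall>a\<in>l1_space. c * (\<Sum>n. \<bar>a n\<bar>) \<le> nrm (T a) \<and> nrm (T a) \<le> C * (\<Sum>n. \<bar>a n\<bar>)))"

definition wrn_witness ::
    "'k topology \<Rightarrow> 'e set \<Rightarrow> ('e \<Rightarrow> 'e \<Rightarrow> 'e) \<Rightarrow> 'e \<Rightarrow> (real \<Rightarrow> 'e \<Rightarrow> 'e) \<Rightarrow> ('e \<Rightarrow> real) \<Rightarrow> bool" where
  "wrn_witness K E add zero scl nrm \<longleftrightarrow>
     banach_space_on E add zero scl nrm \<and>
     \<not> contains_l1 E add scl nrm \<and>
     (\<exists>S. compactin (weak_star_topology E add scl nrm) S \<and>
          K homeomorphic_space subtopology (weak_star_topology E add scl nrm) S)"

text \<open>
  The type \<open>nat \<Rightarrow> 'k \<times> 'k \<Rightarrow> real\<close> is only a bound on the size of the underlying set of the Banach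
  space. By lemma \<open>weakly_radon_nikodymI\<close> below it is no restriction: a witness on any type of
  class \<open>banach\<close>, however large, yields one whose underlying set fits into that type.
\<close>

definition weakly_radon_nikodym :: "'k topology \<Rightarrow> bool" where
  "weakly_radon_nikodym K \<longleftrightarrow>
     compact_space K \<and>
     (\<exists>(E :: (nat \<Rightarrow> 'k \<times> 'k \<Rightarrow> real) set) add zero scl nrm. wrn_witness K E add zero scl nrm)"

lemma closure_span_coding:
  fixes X :: "'i \<Rightarrow> 'e::real_normed_vector"
  obtains dec :: "(nat \<Rightarrow> 'i \<Rightarrow> real) \<Rightarrow> 'e" where "closure (span (range X)) \<subseteq> range dec"
proof
  let ?comb = "\<lambda>g :: 'i \<Rightarrow> real. \<Sum>z | g z \<noteq> 0. g z *\<^sub>R X z"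
  let ?dec = "\<lambda>g :: nat \<Rightarrow> 'i \<Rightarrow> real. lim (\<lambda>n. ?comb (g n))"
  have span: "\<exists>g. x = ?comb g" if "x \<in> span (range X)" for x
  proof -
    obtain t f where t: "finite t" "t \<subseteq> range X" and x: "x = (\<Sum>a\<in>t. f a *\<^sub>R a)"
      using \<open>x \<in> span (range X)\<close> unfolding span_explicit mem_Collect_eq
      by (elim exE conjE) (rule that; assumption)
    obtain U where inj: "inj_on X U" and tU: "t = X ` U"
      using t(2)[unfolded subset_image_inj] by (elim exE conjE) (rule that)
    have fin: "finite U"
      using t(1) inj tU by (simp add: finite_image_iff)
    have "x = (\<Sum>z\<in>U. f (X z) *\<^sub>R X z)"
      unfolding x tU by (simp add: sum.reindex[OF inj])
    also have "\<dots> = ?comb (\<lambda>z. if z \<in> U then f (X z) else 0)"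
      using fin by (intro sum.mono_neutral_cong_right) auto
    finally show ?thesis by (rule exI[where x = "\<lambda>z. if z \<in> U then f (X z) else 0"])
  qed
  show "closure (span (range X)) \<subseteq> range ?dec"
  proof (rule subsetI)
    fix x assume "x \<in> closure (span (range X))"
    then obtain s where s: "\<And>n. s n \<in> span (range X)" and lim: "s \<longlonglongrightarrow> x"
      unfolding closure_sequential by blast
    have "\<forall>n. \<exists>g. s n = ?comb g" using span[OF s] by (rule allI)
    then obtain g where "\<forall>n. s n = ?comb (g n)" by (elim choice[elim_format] exE) (rule that)
    hence "s = (\<lambda>n. ?comb (g n))" by (intro ext) (rule spec)
    with lim have "?dec g = x" by (simp only: limI)
    thus "x \<in> range ?dec" by (intro range_eqI[where x = g]) (rule sym)
  qed
qed

lemma weakly_radon_nikodymI: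
  fixes K :: "'k topology"
  assumes "wrn_witness K (UNIV :: 'e::banach set) (+) 0 scaleR norm"
  shows "weakly_radon_nikodym K"
proof -
  let ?W = "weak_star_topology (UNIV :: 'e set) (+) scaleR norm"
  let ?D = "dual_on (UNIV :: 'e set) (+) scaleR norm"
  from assms obtain S where nl1: "\<not> contains_l1 (UNIV :: 'e set) (+) scaleR norm"
    and S: "compactin ?W S" and hom: "K homeomorphic_space subtopology ?W S"
    unfolding wrn_witness_def by blast
  have cK: "compact_space K"
    using S hom homeomorphic_compact_space compact_space_subtopology by blast
  obtain f where f: "homeomorphic_map K (subtopology ?W S) f"
    using hom unfolding homeomorphic_space by blast
  have fcont: "continuous_map K euclideanreal (\<lambda>p. f p x)" for x
  proof -
    have "continuous_map K (powertop_real UNIV) f"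
      using homeomorphic_imp_continuous_map[OF f]
      unfolding weak_star_topology_def continuous_map_in_subtopology by blast
    thus ?thesis by (simp add: continuous_map_componentwise_UNIV)
  qed
  have fD: "f p \<in> ?D" if "p \<in> topspace K" for p
    using homeomorphic_imp_surjective_map[OF f] that
    unfolding weak_star_topology_def by auto
  have finj: "inj_on f (topspace K)"
    using homeomorphic_imp_injective_map[OF f] .
  define X :: "'k \<times> 'k \<Rightarrow> 'e" where "X = (\<lambda>(p, q). SOME x. f p x \<noteq> f q x)"
  have X: "f p (X (p, q)) \<noteq> f q (X (p, q))" if "p \<in> topspace K" "q \<in> topspace K" "p \<noteq> q" for p q
  proof -
    have "f p \<noteq> f q" using finj that by (auto dest: inj_onD)
    hence "\<exists>x. f p x \<noteq> f q x" by auto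
    thus ?thesis unfolding X_def prod.case by (rule someI_ex)
  qed
  define E' where "E' = closure (span (range X))"
  have sub: "subspace E'"
    unfolding E'_def
  proof (rule subspaceI)
    show "0 \<in> closure (span (range X))"
      by (meson closure_subset span_zero subsetD)
  next
    fix x y assume "x \<in> closure (span (range X))" "y \<in> closure (span (range X))"
    then obtain s t where s: "\<And>n. s n \<in> span (range X)" "s \<longlonglongrightarrow> x"
      and t: "\<And>n. t n \<in> span (range X)" "t \<longlonglongrightarrow> y"
      unfolding closure_sequential by blast
    have "\<forall>n. s n + t n \<in> span (range X)" "(\<lambda>n. s n + t n) \<longlonglongrightarrow> x + y"
      using s t by (auto intro: span_add tendsto_add)
    thus "x + y \<in> closure (span (range X))" unfolding closure_sequential by (intro exI conjI)
  next
    fix c x assume "x \<in> closure (span (range X))"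
    then obtain s where s: "\<And>n. s n \<in> span (range X)" "s \<longlonglongrightarrow> x"
      unfolding closure_sequential by blast
    have "\<forall>n. c *\<^sub>R s n \<in> span (range X)" "(\<lambda>n. c *\<^sub>R s n) \<longlonglongrightarrow> c *\<^sub>R x"
      using s by (auto intro: span_scale tendsto_scaleR)
    thus "c *\<^sub>R x \<in> closure (span (range X))" unfolding closure_sequential by (intro exI conjI)
  qed
  have clo: "closed E'" unfolding E'_def by simp
  obtain dec :: "(nat \<Rightarrow> 'k \<times> 'k \<Rightarrow> real) \<Rightarrow> 'e" where dec: "E' \<subseteq> range dec"
    unfolding E'_def by (rule closure_span_coding)
  define enc where "enc = inv dec"
  have de: "dec (enc x) = x" if "x \<in> E'" for x
    unfolding enc_def using dec that by (simp add: f_inv_into_f subset_iff)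
  define F where "F = enc ` E'"
  define add where "add = (\<lambda>x y. enc (dec x + dec y))"
  define scl where "scl = (\<lambda>c x. enc (c *\<^sub>R dec x))"
  define nrm where "nrm = (\<lambda>x. norm (dec x))"
  have dF: "dec x \<in> E'" "enc (dec x) = x" if "x \<in> F" for x
    using that de unfolding F_def by auto
  have eF: "enc x \<in> F" if "x \<in> E'" for x using that unfolding F_def by blast
  have E'_add: "x + y \<in> E'" if "x \<in> E'" "y \<in> E'" for x y using sub that by (rule subspace_add)
  have E'_scale: "c *\<^sub>R x \<in> E'" if "x \<in> E'" for x c using sub that by (rule subspace_scale)
  have E'_0: "0 \<in> E'" using sub by (rule subspace_0)
  have dadd: "dec (add x y) = dec x + dec y" if "x \<in> F" "y \<in> F" for x y
    unfolding add_def using that by (simp add: de E'_add dF)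
  have dscale: "dec (scl c x) = c *\<^sub>R dec x" if "x \<in> F" for x c
    unfolding scl_def using that by (simp add: de E'_scale dF)
  have addF: "add x y \<in> F" if "x \<in> F" "y \<in> F" for x y
    unfolding add_def using that by (simp add: eF E'_add dF)
  have scaleF: "scl c x \<in> F" if "x \<in> F" for x c
    unfolding scl_def using that by (simp add: eF E'_scale dF)
  have F_eqI: "x = y" if "x \<in> F" "y \<in> F" "dec x = dec y" for x y
    using that dF(2) by metis
  have F0: "enc 0 \<in> F" and d0: "dec (enc 0) = 0" using E'_0 by (auto simp: eF de)
  note F = dadd dscale addF scaleF F0 d0
  have ban: "banach_space_on F add (enc 0) scl nrm"
  proof
    fix x y z and c d :: real
    show "enc 0 \<in> F" by (rule F0)
    { assume x: "x \<in> F"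
      show "scl c x \<in> F" using x by (rule scaleF)
      show "add x (enc 0) = x" using x by (intro F_eqI) (simp_all add: F)
      show "add x (scl (- 1) x) = enc 0" using x by (intro F_eqI) (simp_all add: F)
      show "scl (c + d) x = add (scl c x) (scl d x)"
        using x by (intro F_eqI) (simp_all add: F scaleR_add_left)
      show "scl c (scl d x) = scl (c * d) x" using x by (intro F_eqI) (simp_all add: F)
      show "scl 1 x = x" using x by (intro F_eqI) (simp_all add: F)
      show "0 \<le> nrm x" by (simp add: nrm_def)
      show "nrm x = 0 \<longleftrightarrow> x = enc 0" using x F_eqI[OF x F0] by (auto simp: nrm_def d0)
      show "nrm (scl c x) = \<bar>c\<bar> * nrm x" using x by (simp add: nrm_def F)
      { assume y: "y \<in> F"
        show "add x y \<in> F" using x y by (rule addF)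
        show "add x y = add y x" using x y by (intro F_eqI) (simp_all add: F)
        show "scl c (add x y) = add (scl c x) (scl c y)"
          using x y by (intro F_eqI) (simp_all add: F scaleR_add_right)
        show "nrm (add x y) \<le> nrm x + nrm y" using x y by (simp add: nrm_def F norm_triangle_ineq)
        assume z: "z \<in> F"
        show "add (add x y) z = add x (add y z)"
          using x y z by (intro F_eqI) (simp_all add: F) } }
  next
    fix s :: "nat \<Rightarrow> nat \<Rightarrow> 'k \<times> 'k \<Rightarrow> real"
    assume s: "\<And>n. s n \<in> F"
      and C: "\<And>e. e > 0 \<Longrightarrow> \<exists>N. \<forall>m\<ge>N. \<forall>n\<ge>N. nrm (add (s m) (scl (- 1) (s n))) < e"
    have "Cauchy (\<lambda>n. dec (s n))"
      unfolding Cauchy_def dist_norm using C s by (simp add: nrm_def F)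
    then obtain l where l: "(\<lambda>n. dec (s n)) \<longlonglongrightarrow> l"
      by (auto simp: Cauchy_convergent_iff convergent_def)
    have lE: "l \<in> E'"
      using closed_sequentially[OF clo _ l] s dF(1) by simp
    have "(\<lambda>n. norm (dec (s n) - l)) \<longlonglongrightarrow> 0"
      using l by (simp add: LIM_zero tendsto_norm_zero)
    hence "(\<lambda>n. nrm (add (s n) (scl (- 1) (enc l)))) \<longlonglongrightarrow> 0"
      using s lE by (simp add: nrm_def F eF de)
    thus "\<exists>l\<in>F. (\<lambda>n. nrm (add (s n) (scl (- 1) l))) \<longlonglongrightarrow> 0"
      using eF[OF lE] by blast
  qed
  have nl1': "\<not> contains_l1 F add scl nrm"
  proof
    assume "contains_l1 F add scl nrm"
    then obtain T c C where T: "c > 0" "T ` l1_space \<subseteq> F"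
        "\<forall>a\<in>l1_space. \<forall>b\<in>l1_space.
           T (\<lambda>n. a n + b n) = add (T a) (T b)"
        "\<forall>t. \<forall>a\<in>l1_space. T (\<lambda>n. t * a n) = scl t (T a)"
        "\<forall>a\<in>l1_space.
           c * (\<Sum>n. \<bar>a n\<bar>) \<le> nrm (T a) \<and> nrm (T a) \<le> C * (\<Sum>n. \<bar>a n\<bar>)"
      unfolding contains_l1_def by (elim exE conjE) (rule that; assumption)
    have "contains_l1 (UNIV :: 'e set) (+) scaleR norm"
      unfolding contains_l1_def
    proof (intro exI conjI)
      show "c > 0" by (rule T(1))
      show "\<forall>a\<in>l1_space.
           c * (\<Sum>n. \<bar>a n\<bar>) \<le> norm ((dec \<circ> T) a) \<and> norm ((dec \<circ> T) a) \<le> C * (\<Sum>n. \<bar>a n\<bar>)"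
        using T(5) by (simp add: nrm_def)
    qed (use T in \<open>auto simp: image_subset_iff F\<close>)
    with nl1 show False by blast
  qed
  let ?V = "weak_star_topology F add scl nrm"
  define g where "g = (\<lambda>p. restrict (\<lambda>y. f p (dec y)) F)"
  have gD: "g p \<in> dual_on F add scl nrm" if p: "p \<in> topspace K" for p
  proof -
    obtain M where "\<forall>x. \<bar>f p x\<bar> \<le> M * norm x"
      using fD[OF p] unfolding dual_on_def by blast
    hence "\<exists>M. \<forall>x\<in>F. \<bar>g p x\<bar> \<le> M * nrm x" unfolding g_def nrm_def by auto
    thus ?thesis using fD[OF p] unfolding dual_on_def by (auto simp: g_def F)
  qed
  have gcont: "continuous_map K ?V g"
    unfolding weak_star_topology_def continuous_map_in_subtopology continuous_map_componentwise
    using gD fcont by (auto simp: g_def)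
  have ginj: "inj_on g (topspace K)"
  proof (rule inj_onI, rule ccontr)
    fix p q assume pq: "p \<in> topspace K" "q \<in> topspace K" "g p = g q" "p \<noteq> q"
    have "X (p, q) \<in> E'"
      unfolding E'_def by (meson closure_subset rangeI span_base subsetD)
    hence "f p (X (p, q)) = f q (X (p, q))"
      using fun_cong[OF pq(3), of "enc (X (p, q))"] by (simp add: g_def eF de)
    with X pq show False by blast
  qed
  have "Hausdorff_space ?V"
    unfolding weak_star_topology_def
    by (intro Hausdorff_space_subtopology) (simp add: Hausdorff_space_product_topology)
  hence "embedding_map K ?V g"
    using continuous_imp_embedding_map gcont cK ginj by blast
  hence "K homeomorphic_space subtopology ?V (g ` topspace K)"
    by (rule embedding_map_imp_homeomorphic_space)
  moreover have "compactin ?V (g ` topspace K)"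
    using image_compactin gcont cK unfolding compact_space_def by blast
  ultimately have "wrn_witness K F add (enc 0) scl nrm"
    unfolding wrn_witness_def using ban nl1' by blast
  thus ?thesis unfolding weakly_radon_nikodym_def using cK by blast
qed

end

theory Submission
  imports Defs
begin

text \<open>
  Consider the tree of finite sequences of natural numbers with a copy of a dense subset of the Cantor
  set attached to each node. The algebra is generated by the cones of the tree, by the basic clopen
  sets over the single nodes, and by one set \<open>branch \<sigma>\<close> for each infinite branch \<open>\<sigma>\<close>. Over the \<open>n\<close>-th node
  of \<open>\<sigma>\<close> this set is the clopen set number \<open>\<sigma> n\<close> of a fixed independent sequence in the Cantor set.

  The cones and the basic clopen sets form a family in which any two sets are disjoint or comparable,
  and \<open>branch \<sigma>\<close> meets every other generator, or its complement, in a set of the countable algebra that they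
  generate. So every generator splits at most one ultrafilter of the algebra of the previous ones, which makes all
  the extensions minimal (\<open>minimally_generated_two_layers\<close>). The Stone space is separable because
  the sets are subsets of a countable set. For an ultrafilter \<open>U\<close>, the function that tells whether
  \<open>branch \<sigma> \<in> U\<close> is of the first Baire class in \<open>\<sigma>\<close>: it is a limit of functions of finitely many terms of \<open>\<sigma>\<close>
  because \<open>U\<close> contains all the cones along at most one branch (\<open>branch_baire_one\<close>).

  Suppose that the Stone space is a weak* compact subset of the dual of a Banach space \<open>E\<close>. By
  compactness, each clopen set is separated from its complement by finitely many vectors of \<open>E\<close>. By a
  diagonal argument (\<open>covering_diagonal\<close>) there are a number \<open>m\<close> and a node \<open>u\<close> such that for every \<open>i\<close>
  some branch through the child \<open>i\<close> of \<open>u\<close> needs only \<open>m\<close> vectors of norm at most \<open>m\<close>. Over \<open>u\<close> these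
  branches give the whole independent sequence of clopen subsets of a Cantor set. Since the values
  of \<open>m\<close> bounded functions can be described by finitely many colours, a pigeonhole argument on smaller and smaller
  clopen pieces (\<open>stable_colour\<close>) yields one function for each of infinitely many \<open>i\<close> and one pair of
  levels such that every small piece is cut by almost all of these functions at these levels. From them an
  independent sequence can be chosen (\<open>independent_sequence\<close>), and it spans a copy of the space of
  absolutely summable sequences in \<open>E\<close> (\<open>contains_l1I\<close>). Working with all clopen pieces of a Cantor set takes
  the place of Rosenthal's theorem on sequences without weakly Cauchy subsequences.
\<close>

section \<open>Minimal extensions and minimally generated algebras\<close>

abbreviation algebra_generated_by :: "'a::boolean_algebra set \<Rightarrow> 'a set" where
  "algebra_generated_by G \<equiv> boolean_subalgebra hull G"

lemma boolean_subalgebra_generated: "boolean_subalgebra (algebra_generated_by G)"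
  by (rule hull_in) (auto simp: boolean_subalgebra_def)

lemma boolean_subalgebraD:
  assumes "boolean_subalgebra A"
  shows "bot \<in> A" "top \<in> A" "a \<in> A \<Longrightarrow> - a \<in> A"
    "a \<in> A \<Longrightarrow> b \<in> A \<Longrightarrow> inf a b \<in> A" "a \<in> A \<Longrightarrow> b \<in> A \<Longrightarrow> sup a b \<in> A"
  using assms by (auto simp: boolean_subalgebra_def)

lemma boolean_subalgebraI:
  assumes "bot \<in> A" "top \<in> A" "\<And>a. a \<in> A \<Longrightarrow> - a \<in> A"
    "\<And>a b. a \<in> A \<Longrightarrow> b \<in> A \<Longrightarrow> inf a b \<in> A" "\<And>a b. a \<in> A \<Longrightarrow> b \<in> A \<Longrightarrow> sup a b \<in> A"
  shows "boolean_subalgebra A"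
  using assms by (auto simp: boolean_subalgebra_def)

lemmas generated_closed = boolean_subalgebraD[OF boolean_subalgebra_generated]

lemma inf_compl_cong:
  fixes x :: "'a::boolean_algebra"
  assumes "inf x a = inf x b"
  shows "inf x (- a) = inf x (- b)"
proof -
  have "inf x (- c) = inf x (- inf x c)" for c by (simp add: inf_sup_distrib1)
  from this[of a] this[of b] show ?thesis unfolding assms by simp
qed

lemma split_by:
  fixes x :: "'a::boolean_algebra"
  shows "sup (inf x e) (inf (- x) e) = e"
  by (simp flip: inf_sup_distrib2)

lemma inf_glued:
  fixes x :: "'a::boolean_algebra"
  shows "inf x (sup (inf x b) (inf (- x) d)) = inf x b"
    "inf (- x) (sup (inf x b) (inf (- x) d)) = inf (- x) d"
  by (simp_all add: inf_sup_distrib1 flip: inf_assoc)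

lemma generated_one_elementE:
  fixes B :: "'a::boolean_algebra set"
  assumes B: "boolean_subalgebra B" and c: "c \<in> algebra_generated_by (insert x B)"
  obtains b d where "b \<in> B" "d \<in> B" "c = sup (inf x b) (inf (- x) d)"
proof -
  define C where "C = {c. \<exists>b\<in>B. \<exists>d\<in>B. c = sup (inf x b) (inf (- x) d)}"
  have CI: "sup (inf x b) (inf (- x) d) \<in> C" if "b \<in> B" "d \<in> B" for b d
    using that by (auto simp: C_def)
  note cl = boolean_subalgebraD[OF B]
  have "boolean_subalgebra C"
    unfolding boolean_subalgebra_def
  proof (intro conjI ballI)
    show "bot \<in> C" "top \<in> C"
      using CI[OF cl(1) cl(1)] CI[OF cl(2) cl(2)] by simp_all
  next
    fix a assume "a \<in> C"
    then obtain b d where bd: "b \<in> B" "d \<in> B" and a: "a = sup (inf x b) (inf (- x) d)"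
      unfolding C_def by blast
    have "inf x (- a) = inf x (- b)" "inf (- x) (- a) = inf (- x) (- d)"
      unfolding a by (rule inf_compl_cong, rule inf_glued)+
    hence "- a = sup (inf x (- b)) (inf (- x) (- d))"
      using split_by[of x "- a"] by simp
    thus "- a \<in> C" using CI[of "- b" "- d"] bd cl(3) by simp
  next
    fix a a' assume "a \<in> C" "a' \<in> C"
    then obtain b d b' d' where bd: "b \<in> B" "d \<in> B" "b' \<in> B" "d' \<in> B"
      and a: "a = sup (inf x b) (inf (- x) d)" "a' = sup (inf x b') (inf (- x) d')"
      unfolding C_def by blast
    have "sup a a' = sup (inf x (sup b b')) (inf (- x) (sup d d'))"
      unfolding a by (simp add: inf_sup_distrib1 ac_simps)
    thus "sup a a' \<in> C" using CI[of "sup b b'" "sup d d'"] bd cl(5) by simp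
    have z: "inf (inf x p) (inf (- x) q) = bot" "inf (inf (- x) q) (inf x p) = bot" for p q
    proof -
      have "inf (inf x p) (inf (- x) q) = inf (inf x (- x)) (inf p q)" by (simp only: ac_simps)
      thus "inf (inf x p) (inf (- x) q) = bot" by simp
      thus "inf (inf (- x) q) (inf x p) = bot" by (simp only: inf_commute)
    qed
    have "inf a a' = sup (inf (inf x b) (inf x b')) (inf (inf (- x) d) (inf (- x) d'))"
      unfolding a by (simp add: inf_sup_distrib1 inf_sup_distrib2 z)
    also have "\<dots> = sup (inf x (inf b b')) (inf (- x) (inf d d'))"
      by (simp add: ac_simps)
    finally show "inf a a' \<in> C" using CI[of "inf b b'" "inf d d'"] bd cl(4) by simp
  qed
  moreover have "insert x B \<subseteq> C"
  proof
    fix a assume "a \<in> insert x B"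
    thus "a \<in> C"
    proof
      assume "a = x" thus ?thesis using CI[OF cl(2) cl(1)] by simp
    next
      assume "a \<in> B"
      moreover have "a = sup (inf x a) (inf (- x) a)"
        by (simp only: split_by)
      ultimately show ?thesis using CI[of a a] by simp
    qed
  qed
  ultimately have "algebra_generated_by (insert x B) \<subseteq> C" by (rule hull_minimal[rotated])
  with c that show thesis unfolding C_def by blast
qed

text \<open>
  The hypothesis says that the elements \<open>b\<close> of \<open>B\<close> below which \<open>x\<close> is still in \<open>B\<close> form a maximal
  ideal, so the dual ultrafilter is the only one of \<open>B\<close> that \<open>x\<close> can split. An element
  \<open>c = (x \<inter> b) \<union> (-x \<inter> d)\<close> with \<open>b\<close> and \<open>d\<close> on the same side of that ultrafilter agrees with \<open>b\<close>, up to an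
  element of the ideal, and hence is in \<open>B\<close>; if \<open>b\<close> and \<open>d\<close> are on different sides, then \<open>c\<close> agrees
  with \<open>x\<close> or \<open>-x\<close> near the ultrafilter, and \<open>x\<close> can be recovered from \<open>c\<close> and \<open>B\<close>.
\<close>
lemma minimal_extensionI:
  fixes B :: "'a::boolean_algebra set"
  assumes B: "boolean_subalgebra B" and x: "x \<notin> B"
    and split: "\<And>b. b \<in> B \<Longrightarrow> inf x b \<in> B \<or> inf x (- b) \<in> B"
  shows "minimal_extension B (algebra_generated_by (insert x B))"
  unfolding minimal_extension_def
proof (intro conjI exI[of _ x] allI impI)
  fix C assume C: "boolean_subalgebra C \<and> B \<subseteq> C \<and> C \<subseteq> algebra_generated_by (insert x B)"
  note cl = boolean_subalgebraD[OF B]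
  have C': "boolean_subalgebra C" "B \<subseteq> C" using C by auto
  note cC = boolean_subalgebraD[OF C'(1)]
  show "C = B \<or> C = algebra_generated_by (insert x B)"
  proof (cases "C \<subseteq> B")
    case False
    then obtain c where cCB: "c \<in> C" "c \<notin> B" by blast
    then obtain b d where bd: "b \<in> B" "d \<in> B" and c: "c = sup (inf x b) (inf (- x) d)"
      using generated_one_elementE[OF B] C by blast
    have dx: "inf (- x) e \<in> B" if "e \<in> B" "inf x e \<in> B" for e
    proof -
      have "inf (- x) e = inf e (- inf x e)"
        by (simp add: inf_sup_distrib1 ac_simps)
      thus ?thesis using cl(4)[OF that(1) cl(3)[OF that(2)]] by simp
    qed
    have inC: "b \<in> C" "d \<in> C" "- b \<in> C" "- d \<in> C" using bd C'(2) cC(3) by auto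
    have whole: "x = sup (inf x e) (inf x (- e))" for e
      by (simp flip: inf_sup_distrib1)
    have "x \<in> C"
    proof (cases "inf x b \<in> B")
      case True
      have nd: "inf x d \<notin> B"
      proof
        assume "inf x d \<in> B"
        hence "c \<in> B" unfolding c using True dx[OF bd(2)] cl by blast
        thus False using cCB by blast
      qed
      hence d: "inf x (- d) \<in> B" using split bd(2) by blast
      let ?e = "inf d (- b)"
      have "inf c (inf d (- b)) = inf (- x) (inf d (- b))"
        unfolding c by (simp add: inf_sup_distrib1 inf_sup_distrib2 ac_simps)
      hence "inf (- x) ?e \<in> C" using cC(4)[OF cCB(1) cC(4)[OF inC(2,3)]] by simp
      hence "inf ?e (- inf (- x) ?e) \<in> C" by (rule cC(4)[OF cC(4)[OF inC(2,3)] cC(3)])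
      moreover have "inf ?e (- inf (- x) ?e) = inf x ?e"
        by (simp add: inf_sup_distrib1 ac_simps)
      moreover have "inf x (- ?e) \<in> C"
      proof -
        have "inf x (- ?e) = sup (inf x (- d)) (inf x b)" by (simp add: inf_sup_distrib1)
        thus ?thesis using cC(5)[OF subsetD[OF C'(2) d] subsetD[OF C'(2) True]] by simp
      qed
      ultimately show ?thesis using whole[of ?e] cC(5)[of "inf x ?e" "inf x (- ?e)"] by simp
    next
      case False
      hence b: "inf x (- b) \<in> B" using split bd(1) by blast
      show ?thesis
      proof (cases "inf x d \<in> B")
        case True
        let ?e = "inf b (- d)"
        have "inf c ?e = inf x ?e"
          unfolding c by (simp add: inf_sup_distrib1 inf_sup_distrib2 ac_simps)
        hence "inf x ?e \<in> C" using cC(4)[OF cCB(1) cC(4)[OF inC(1,4)]] by simp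
        moreover have "inf x (- ?e) = sup (inf x (- b)) (inf x d)"
          by (simp add: inf_sup_distrib1)
        hence "inf x (- ?e) \<in> C"
          using cC(5)[OF subsetD[OF C'(2) b] subsetD[OF C'(2) True]] by simp
        ultimately show ?thesis using whole[of ?e] cC(5)[of "inf x ?e" "inf x (- ?e)"] by simp
      next
        case False
        hence d: "inf x (- d) \<in> B" using split bd(2) by blast
        have "- c = sup (inf x (- b)) (inf (- x) (- d))"
        proof -
          have "inf x (- c) = inf x (- b)" "inf (- x) (- c) = inf (- x) (- d)"
            unfolding c by (rule inf_compl_cong, rule inf_glued)+
          thus ?thesis using split_by[of x "- c"] by simp
        qed
        hence "- c \<in> B" using cl(5)[OF b dx[OF cl(3)[OF bd(2)] d]] by simp
        hence "c \<in> B" using cl(3) by fastforce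
        thus ?thesis using cCB by blast
      qed
    qed
    hence "algebra_generated_by (insert x B) \<subseteq> C" using C' by (intro hull_minimal) auto
    thus ?thesis using C by blast
  qed (use C in blast)
qed (use B x in auto)

text \<open>
  The elements that satisfy the splitting condition are closed under meets and complements, which
  makes the criterion of minimality a condition on pairs of generators.
\<close>
lemma splitting_on_generators:
  fixes B :: "'a::boolean_algebra set"
  assumes B: "boolean_subalgebra B" and H: "H \<subseteq> B"
    and gen: "\<And>g. g \<in> H \<Longrightarrow> inf x g \<in> B \<or> inf x (- g) \<in> B"
    and b: "b \<in> algebra_generated_by H"
  shows "inf x b \<in> B \<or> inf x (- b) \<in> B"
proof -
  note cl = boolean_subalgebraD[OF B]
  define P where "P b \<longleftrightarrow> b \<in> B \<and> (inf x b \<in> B \<or> inf x (- b) \<in> B)" for b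
  have inf: "P (inf a b)" if a: "P a" and b: "P b" for a b
  proof -
    have "inf x (- inf a b) = sup (inf x (- a)) (inf x (- b))" by (simp add: inf_sup_distrib1)
    moreover have "inf x (inf a b) = inf (inf x a) b" "inf x (inf a b) = inf (inf x b) a"
      by (simp_all add: ac_simps)
    ultimately show ?thesis
      using a b cl(4)[of a b] cl(4)[of "inf x a" b] cl(4)[of "inf x b" a]
        cl(5)[of "inf x (- a)" "inf x (- b)"]
      unfolding P_def by auto
  qed
  have neg: "P (- a)" if "P a" for a using that cl(3) by (auto simp: P_def)
  have sup: "P (sup a b)" if "P a" "P b" for a b
    using neg[OF inf[OF neg[OF that(1)] neg[OF that(2)]]] by simp
  have "P bot" "P top" by (simp_all add: P_def cl(1,2))
  hence "boolean_subalgebra {b. P b}"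
    using inf neg sup by (simp add: boolean_subalgebra_def)
  with gen H have "P b" by - (rule hull_induct[OF b], auto simp: P_def)
  thus ?thesis by (simp add: P_def)
qed


text \<open>
  At a limit no generator before \<open>j\<close> is the last one, so each of them is already used at some earlier
  index; the union is an algebra because it is directed.
\<close>
lemma generated_UN_underS:
  fixes r :: "'a::boolean_algebra rel"
  assumes r: "Well_order r" and j: "j \<in> Field r" and ne: "underS r j \<noteq> {}"
    and lim: "\<forall>i\<in>Field r. underS r j \<noteq> under r i"
  shows "algebra_generated_by (underS r j) = (\<Union>i\<in>underS r j. algebra_generated_by (underS r i))"
proof -
  define R where "R = (\<Union>i\<in>underS r j. algebra_generated_by (underS r i))"
  have tr: "trans r" and an: "antisym r" and to: "total_on (Field r) r" and re: "refl_on (Field r) r"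
    using r by (auto simp: well_order_on_def linear_order_on_def partial_order_on_def preorder_on_def)
  have mono: "underS r i \<subseteq> underS r k" if "(i, k) \<in> r" for i k
    by (rule underS_incr[OF tr an that])
  have "R \<subseteq> algebra_generated_by (underS r j)"
  unfolding R_def
  proof (rule UN_least)
    fix i assume "i \<in> underS r j"
    thus "algebra_generated_by (underS r i) \<subseteq> algebra_generated_by (underS r j)"
      by (intro hull_mono mono) (simp add: underS_def)
  qed
  have dir: "\<exists>k\<in>underS r j. algebra_generated_by (underS r i) \<subseteq> algebra_generated_by (underS r k) \<and>
      algebra_generated_by (underS r i') \<subseteq> algebra_generated_by (underS r k)"
    if ii: "i \<in> underS r j" "i' \<in> underS r j" for i i'
  proof -
    have F: "i \<in> Field r" "i' \<in> Field r" using ii underS_Field by fastforce+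
    hence "(i, i') \<in> r \<or> (i', i) \<in> r"
      using to re by (cases "i = i'") (auto simp: total_on_def dest: refl_onD)
    thus ?thesis using mono ii by (meson hull_mono order_refl)
  qed
  have "boolean_subalgebra R"
    unfolding boolean_subalgebra_def
  proof (intro conjI ballI)
    show "bot \<in> R" "top \<in> R" using ne generated_closed(1,2) unfolding R_def by blast+
  next
    fix a assume "a \<in> R" thus "- a \<in> R" using generated_closed(3) unfolding R_def by blast
  next
    fix a b assume "a \<in> R" "b \<in> R"
    then obtain k where k: "k \<in> underS r j"
      "a \<in> algebra_generated_by (underS r k)" "b \<in> algebra_generated_by (underS r k)"
      using dir unfolding R_def by (smt (verit) UN_iff subsetD)
    show "inf a b \<in> R" using k generated_closed(4) unfolding R_def by blast
    show "sup a b \<in> R" using k generated_closed(5) unfolding R_def by blast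
  qed
  moreover have "underS r j \<subseteq> R"
  proof
    fix i assume i: "i \<in> underS r j"
    have iF: "i \<in> Field r" using i underS_Field by fastforce
    have "under r i \<subseteq> underS r j"
      using i tr an unfolding under_def underS_def trans_def antisym_def by blast
    then obtain k where k: "k \<in> underS r j" "k \<notin> under r i" using lim iF by blast
    have "k \<in> Field r" using k underS_Field by fastforce
    hence "(i, k) \<in> r \<and> i \<noteq> k"
      using k(2) iF to re by (cases "i = k") (auto simp: total_on_def under_def dest: refl_onD)
    hence "i \<in> underS r k" by (simp add: underS_def)
    thus "i \<in> R" unfolding R_def using k(1) by (blast intro: hull_inc)
  qed
  ultimately have "algebra_generated_by (underS r j) \<subseteq> R" by (rule hull_minimal[rotated])
  with \<open>R \<subseteq> algebra_generated_by (underS r j)\<close> show ?thesis unfolding R_def by (rule subset_antisym[rotated])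
qed

text \<open>
  The \<open>j\<close>-th algebra of the chain is generated by the indices strictly before \<open>j\<close>, the indices being the
  generators themselves. The largest index \<open>l\<close> is not a generator: it is there because the generators
  may have a largest element, which would otherwise never be adjoined.
\<close>
lemma minimally_generatedI:
  fixes r :: "'a::boolean_algebra rel"
  assumes r: "Well_order r" and last: "l \<in> Field r" "\<And>x. x \<in> Field r \<Longrightarrow> (x, l) \<in> r"
    and new: "\<And>x. x \<in> Field r \<Longrightarrow> x \<noteq> l \<Longrightarrow> x \<notin> algebra_generated_by (underS r x)"
    and split: "\<And>x b. x \<in> Field r \<Longrightarrow> x \<noteq> l \<Longrightarrow> b \<in> underS r x \<Longrightarrow>
      inf x b \<in> algebra_generated_by (underS r x) \<or> inf x (- b) \<in> algebra_generated_by (underS r x)"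
  shows "minimally_generated (algebra_generated_by (underS r l))"
  unfolding minimally_generated_def
proof (intro exI[of _ r] exI[of _ "\<lambda>i. algebra_generated_by (underS r i)"] conjI ballI impI)
  have tr: "trans r" and an: "antisym r" and re: "refl_on (Field r) r"
    using r by (auto simp: well_order_on_def linear_order_on_def partial_order_on_def preorder_on_def)
  note mono = underS_incr[OF tr an]
  show "Well_order r" by fact
  show "algebra_generated_by (underS r l) = (\<Union>i\<in>Field r. algebra_generated_by (underS r i))"
  proof
    show "(\<Union>i\<in>Field r. algebra_generated_by (underS r i)) \<subseteq> algebra_generated_by (underS r l)"
      using last(2) by (intro UN_least hull_mono mono)
  qed (use last(1) in blast)
  fix i
  show "boolean_subalgebra (algebra_generated_by (underS r i))" by (rule boolean_subalgebra_generated)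
  show "case p of (i, j) \<Rightarrow> algebra_generated_by (underS r i) \<subseteq> algebra_generated_by (underS r j)"
    if "p \<in> r" for p using that mono by (cases p) (simp add: hull_mono)
  fix j assume j: "j \<in> Field r"
  { assume e: "underS r j = {}"
    have "algebra_generated_by {} = {bot, top :: 'a}"
      using generated_closed(1,2)[of "{}"]
      by (intro subset_antisym hull_minimal) (auto simp: boolean_subalgebra_def)
    thus "algebra_generated_by (underS r j) = {bot, top}" unfolding e . }
  { assume iF: "i \<in> Field r" and ij: "underS r j = under r i"
    have "i \<noteq> l"
    proof
      assume "i = l"
      hence "j \<in> underS r j" using ij last(2)[OF j] by (simp add: under_def)
      thus False by (simp add: underS_def)
    qed
    have "under r i = insert i (underS r i)"
      using re iF by (simp add: Refl_under_underS)
    hence "algebra_generated_by (underS r j) = algebra_generated_by (insert i (algebra_generated_by (underS r i)))"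
      unfolding ij using hull_Un_right[of boolean_subalgebra "{i}" "underS r i"] by simp
    moreover have "minimal_extension (algebra_generated_by (underS r i))
        (algebra_generated_by (insert i (algebra_generated_by (underS r i))))"
      using new[OF iF \<open>i \<noteq> l\<close>]
        splitting_on_generators[OF boolean_subalgebra_generated hull_subset split[OF iF \<open>i \<noteq> l\<close>]]
      by (intro minimal_extensionI boolean_subalgebra_generated)
    ultimately show "minimal_extension (algebra_generated_by (underS r i)) (algebra_generated_by (underS r j))"
      by simp }
  { assume "underS r j \<noteq> {} \<and> (\<forall>i\<in>Field r. underS r j \<noteq> under r i)"
    thus "algebra_generated_by (underS r j) = (\<Union>i\<in>underS r j. algebra_generated_by (underS r i))"
      by (intro generated_UN_underS[OF r j]) auto }
qed

text \<open>
  A generator that lies in the algebra of its predecessors would be a step at which the chain does not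
  grow. By well-founded induction the remaining generators still generate everything, also on every
  initial segment \<open>D\<close>.
\<close>
lemma generated_by_irredundant:
  fixes G :: "'a::boolean_algebra set"
  assumes wf: "wf s" and trans: "trans s"
  defines "I \<equiv> {x \<in> G. x \<notin> algebra_generated_by {y \<in> G. (y, x) \<in> s}}"
  assumes dc: "D \<subseteq> G" "\<And>x y. x \<in> D \<Longrightarrow> y \<in> G \<Longrightarrow> (y, x) \<in> s \<Longrightarrow> y \<in> D"
  shows "algebra_generated_by (D \<inter> I) = algebra_generated_by D"
proof
  have "x \<in> D \<longrightarrow> x \<in> algebra_generated_by (D \<inter> I)" for x
  proof (induction x rule: wf_induct[OF wf])
    case (1 x)
    show ?case
    proof
      assume x: "x \<in> D"
      show "x \<in> algebra_generated_by (D \<inter> I)"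
      proof (cases "x \<in> I")
        case True thus ?thesis using x by (simp add: hull_inc)
      next
        case False
        hence "x \<in> algebra_generated_by {y \<in> G. (y, x) \<in> s}" using x dc(1) I_def by auto
        moreover have "{y \<in> G. (y, x) \<in> s} \<subseteq> algebra_generated_by (D \<inter> I)" using 1 x dc(2) by blast
        ultimately show ?thesis
          by (meson boolean_subalgebra_generated hull_minimal subsetD)
      qed
    qed
  qed
  hence "D \<subseteq> algebra_generated_by (D \<inter> I)" by blast
  thus "algebra_generated_by D \<subseteq> algebra_generated_by (D \<inter> I)"
    by (rule hull_minimal) (rule boolean_subalgebra_generated)
  show "algebra_generated_by (D \<inter> I) \<subseteq> algebra_generated_by D" by (rule hull_mono) blast
qed

text \<open>
  The elements of \<open>G0\<close> are adjoined first. Their relative order is arbitrary, because in a family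
  in which any two members are disjoint or comparable each member splits at most one ultrafilter of
  the algebra generated by any set of others. For a member of \<open>G1\<close> the second hypothesis says the same, also in the
  presence of any other members of \<open>G1\<close>.
\<close>
lemma minimally_generated_two_layers:
  fixes G0 G1 :: "'a::boolean_algebra set"
  assumes lam: "\<And>x b. x \<in> G0 \<Longrightarrow> b \<in> G0 \<Longrightarrow> inf x b \<in> {bot, x, b}"
    and split: "\<And>x b. x \<in> G1 \<Longrightarrow> b \<in> G0 \<union> G1 \<Longrightarrow> b \<noteq> x \<Longrightarrow>
      inf x b \<in> algebra_generated_by G0 \<or> inf x (- b) \<in> algebra_generated_by G0"
  shows "minimally_generated (algebra_generated_by (G0 \<union> G1))"
proof -
  obtain w :: "'a rel" where w: "well_order_on UNIV w" using well_order_on by blast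
  \<comment> \<open>bottom is never an irredundant generator, so it can serve as the extra last index\<close>
  define rk :: "'a \<Rightarrow> nat" where "rk x = (if x = bot then 2 else if x \<in> G0 then 0 else 1)" for x
  define s where "s = inv_image (less_than <*lex*> (w - Id)) (\<lambda>x. (rk x, x))"
  have s_iff: "(x, y) \<in> s \<longleftrightarrow> rk x < rk y \<or> rk x = rk y \<and> (x, y) \<in> w \<and> x \<noteq> y" for x y
    by (auto simp: s_def)
  have lw: "trans w" "antisym w" "total_on UNIV w" and wfw: "wf (w - Id)"
    using w by (auto simp: well_order_on_def linear_order_on_def partial_order_on_def preorder_on_def)
  have wf: "wf s" unfolding s_def by (intro wf_inv_image wf_lex_prod wf_less_than wfw)
  have tr: "trans s"
    using lw(1,2) unfolding trans_def antisym_def s_iff by (metis order.strict_trans)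
  have tot: "(x, y) \<in> s \<or> (y, x) \<in> s" if "x \<noteq> y" for x y
    using lw(3) that unfolding total_on_def s_iff by (metis UNIV_I nat_neq_iff)
  have irr: "(x, x) \<notin> s" for x by (simp add: s_iff)
  define G where "G = (G0 \<union> G1) - {bot}"
  define below where "below = (\<lambda>x. {y \<in> G. (y, x) \<in> s})"
  define I where "I = {x \<in> G. x \<notin> algebra_generated_by (below x)}"
  have IG: "I \<subseteq> G" by (auto simp: I_def)
  define r where "r = {(x, y). x \<in> insert bot I \<and> y \<in> insert bot I \<and> (x = y \<or> (x, y) \<in> s)}"
  have F: "Field r = insert bot I" by (auto simp: r_def Field_def)
  have wo: "Well_order r"
    unfolding F well_order_on_def linear_order_on_def partial_order_on_def preorder_on_def
  proof (intro conjI)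
    show "refl_on (insert bot I) r" by (auto simp: refl_on_def r_def)
    show "r \<subseteq> insert bot I \<times> insert bot I" by (auto simp: r_def)
    show "trans r" using tr unfolding trans_def r_def by blast
    show "antisym r" using tr irr unfolding antisym_def r_def trans_def by blast
    show "total_on (insert bot I) r" using tot unfolding total_on_def r_def by blast
    show "wf (r - Id)" by (rule wf_subset[OF wf]) (auto simp: r_def)
  qed
  have botlast: "(x, bot) \<in> s" if "x \<in> G" for x using that by (auto simp: s_iff rk_def G_def)
  have nbot: "(bot, x) \<notin> s" if "x \<in> G" for x using that by (auto simp: s_iff rk_def G_def)
  have uS: "underS r x = below x \<inter> I" if "x \<in> I" for x
    using that IG nbot irr unfolding underS_def r_def below_def by blast
  have uSb: "underS r bot = I"
    using IG botlast irr unfolding underS_def r_def by (auto simp: G_def)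
  have same: "algebra_generated_by (underS r x) = algebra_generated_by (below x)" if "x \<in> I" for x
    unfolding uS[OF that] I_def below_def
    by (rule generated_by_irredundant[OF wf tr], blast, use tr in \<open>unfold trans_def, blast\<close>)
  have "algebra_generated_by I = algebra_generated_by (G \<inter> I)" using IG by (simp add: Int_absorb1)
  also have "\<dots> = algebra_generated_by G"
    unfolding I_def below_def by (rule generated_by_irredundant[OF wf tr]) auto
  also have "\<dots> = algebra_generated_by (G0 \<union> G1)"
  proof
    have "G0 \<union> G1 \<subseteq> algebra_generated_by G"
      using generated_closed(1) by (auto simp: G_def intro: hull_inc)
    thus "algebra_generated_by (G0 \<union> G1) \<subseteq> algebra_generated_by G"
      by (rule hull_minimal) (rule boolean_subalgebra_generated)
  qed (auto simp: G_def intro!: hull_mono)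
  finally have gen: "algebra_generated_by (underS r bot) = algebra_generated_by (G0 \<union> G1)"
    unfolding uSb .
  have "minimally_generated (algebra_generated_by (underS r bot))"
  proof (rule minimally_generatedI[OF wo])
    show "bot \<in> Field r" by (simp add: F)
    fix x assume x: "x \<in> Field r"
    show "(x, bot) \<in> r" using x botlast IG unfolding F by (auto simp: r_def)
    assume "x \<noteq> bot"
    hence xI: "x \<in> I" using x F by blast
    show "x \<notin> algebra_generated_by (underS r x)" unfolding same[OF xI] using xI by (simp add: I_def)
    fix b assume "b \<in> underS r x"
    hence b: "b \<in> below x" "b \<noteq> x" using uS[OF xI] irr by (auto simp: below_def)
    show "inf x b \<in> algebra_generated_by (underS r x) \<or> inf x (- b) \<in> algebra_generated_by (underS r x)"
      unfolding same[OF xI]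
    proof (cases "x \<in> G0")
      case True
      have "x \<noteq> bot" using xI IG by (auto simp: G_def)
      with True b have "b \<in> G0" by (auto simp: below_def s_iff rk_def G_def split: if_splits)
      with lam[OF True] consider "inf x b = bot" | "inf x b = x" | "inf x b = b" by blast
      thus "inf x b \<in> algebra_generated_by (below x) \<or> inf x (- b) \<in> algebra_generated_by (below x)"
      proof cases
        case 2
        hence "inf x (- b) = bot" by (simp add: inf_shunt inf.orderI)
        thus ?thesis by (simp add: generated_closed)
      qed (use b(1) in \<open>auto simp: generated_closed intro: hull_inc\<close>)
    next
      case False
      hence xG: "x \<in> G1" "x \<noteq> bot" using xI IG by (auto simp: G_def)
      have "G0 \<subseteq> algebra_generated_by (below x)"
      proof
        fix g assume g: "g \<in> G0"
        show "g \<in> algebra_generated_by (below x)"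
        proof (cases "g = bot")
          case True thus ?thesis by (simp add: generated_closed)
        next
          case gb: False
          hence "g \<in> below x" using g False xG by (auto simp: below_def s_iff rk_def G_def)
          thus ?thesis by (rule hull_inc)
        qed
      qed
      hence "algebra_generated_by G0 \<subseteq> algebra_generated_by (below x)"
        by (rule hull_minimal) (rule boolean_subalgebra_generated)
      thus "inf x b \<in> algebra_generated_by (below x) \<or> inf x (- b) \<in> algebra_generated_by (below x)"
        using split[OF xG(1), of b] b by (auto simp: below_def G_def)
    qed
  qed
  thus ?thesis unfolding gen .
qed

section \<open>Stone spaces of Boolean algebras\<close>

lemma ultrafilterD:
  assumes A: "boolean_subalgebra A" and U: "U \<in> ultrafilters A"
  shows "U \<subseteq> A" "top \<in> U" "bot \<notin> U"
    "a \<in> U \<Longrightarrow> b \<in> A \<Longrightarrow> a \<le> b \<Longrightarrow> b \<in> U"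
    "a \<in> A \<Longrightarrow> - a \<in> U \<longleftrightarrow> a \<notin> U"
    "a \<in> A \<Longrightarrow> b \<in> A \<Longrightarrow> inf a b \<in> U \<longleftrightarrow> a \<in> U \<and> b \<in> U"
    "a \<in> A \<Longrightarrow> b \<in> A \<Longrightarrow> sup a b \<in> U \<longleftrightarrow> a \<in> U \<or> b \<in> U"
proof -
  note cl = boolean_subalgebraD[OF A]
  show *: "U \<subseteq> A" "top \<in> U" "bot \<notin> U" "a \<in> U \<Longrightarrow> b \<in> A \<Longrightarrow> a \<le> b \<Longrightarrow> b \<in> U" for a b
    using U by (auto simp: ultrafilters_def)
  have inf: "a \<in> U \<Longrightarrow> b \<in> U \<Longrightarrow> inf a b \<in> U" for a b
    using U by (auto simp: ultrafilters_def)
  have tot: "a \<in> A \<Longrightarrow> a \<in> U \<or> - a \<in> U" for a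
    using U by (auto simp: ultrafilters_def)
  have neg: "- a \<in> U \<longleftrightarrow> a \<notin> U" if "a \<in> A" for a
    using inf[of a "- a"] tot[OF that] *(3) by auto
  show "- a \<in> U \<longleftrightarrow> a \<notin> U" if "a \<in> A" for a by (rule neg[OF that])
  show infs: "inf a b \<in> U \<longleftrightarrow> a \<in> U \<and> b \<in> U" if "a \<in> A" "b \<in> A" for a b
    using inf *(4)[of "inf a b" a] *(4)[of "inf a b" b] that by auto
  show "sup a b \<in> U \<longleftrightarrow> a \<in> U \<or> b \<in> U" if "a \<in> A" "b \<in> A" for a b
    using neg[of "inf (- a) (- b)"] infs[of "- a" "- b"] neg[OF that(1)] neg[OF that(2)] that cl by simp
qed

lemma ultrafilter_eqI:
  assumes U: "U \<in> ultrafilters (algebra_generated_by G)" and V: "V \<in> ultrafilters (algebra_generated_by G)"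
    and eq: "\<And>g. g \<in> G \<Longrightarrow> g \<in> U \<longleftrightarrow> g \<in> V"
  shows "U = V"
proof -
  let ?A = "algebra_generated_by G"
  note UD = ultrafilterD[OF boolean_subalgebra_generated U] and VD = ultrafilterD[OF boolean_subalgebra_generated V]
  have "?A \<subseteq> {a \<in> ?A. a \<in> U \<longleftrightarrow> a \<in> V}"
  proof (rule hull_minimal)
    show "boolean_subalgebra {a \<in> ?A. a \<in> U \<longleftrightarrow> a \<in> V}"
      by (rule boolean_subalgebraI) (use UD(2,3,5-7) VD(2,3,5-7) in \<open>simp_all add: generated_closed\<close>)
  qed (use eq in \<open>auto intro: hull_inc\<close>)
  thus ?thesis using UD(1) VD(1) by blast
qed

definition basic_open :: "'a::boolean_algebra set \<Rightarrow> 'a \<Rightarrow> 'a set set" where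
  "basic_open A a = {U \<in> ultrafilters A. a \<in> U}"

lemma stone_space_basic: "stone_space A = topology_generated_by (basic_open A ` A)"
  by (simp add: stone_space_def basic_open_def image_def)

lemma topspace_stone_space:
  assumes A: "boolean_subalgebra A"
  shows "topspace (stone_space A) = ultrafilters A"
proof -
  have "basic_open A top = ultrafilters A"
    using ultrafilterD(2)[OF A] by (auto simp: basic_open_def)
  thus ?thesis
    using boolean_subalgebraD(2)[OF A] unfolding stone_space_basic topology_generated_by_topspace
    by (auto simp: basic_open_def)
qed

lemma openin_basic_open: "a \<in> A \<Longrightarrow> openin (stone_space A) (basic_open A a)"
  unfolding stone_space_basic by (intro topology_generated_by_Basis) simp

lemma closedin_basic_open:
  assumes A: "boolean_subalgebra A" and a: "a \<in> A"
  shows "closedin (stone_space A) (basic_open A a)"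
proof -
  have "ultrafilters A - basic_open A a = basic_open A (- a)"
    using ultrafilterD(5)[OF A _ a] by (auto simp: basic_open_def)
  thus ?thesis
    using openin_basic_open[OF boolean_subalgebraD(3)[OF A a]]
    by (simp add: closedin_def topspace_stone_space[OF A]) (auto simp: basic_open_def)
qed

lemma basic_open_base:
  assumes A: "boolean_subalgebra A" and W: "openin (stone_space A) W" and U: "U \<in> W"
  obtains a where "a \<in> A" "U \<in> basic_open A a" "basic_open A a \<subseteq> W"
proof -
  have "generate_topology_on (basic_open A ` A) W"
    using W by (simp add: stone_space_basic openin_topology_generated_by_iff)
  hence "U \<in> W \<Longrightarrow> \<exists>a\<in>A. U \<in> basic_open A a \<and> basic_open A a \<subseteq> W"
  proof (induction rule: generate_topology_on.induct)
    case (Int S T)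
    then obtain a b where ab: "a \<in> A" "b \<in> A" "U \<in> basic_open A a" "U \<in> basic_open A b"
        "basic_open A a \<subseteq> S" "basic_open A b \<subseteq> T" by blast
    have "basic_open A (inf a b) = basic_open A a \<inter> basic_open A b"
      using ultrafilterD(6)[OF A _ ab(1,2)] by (auto simp: basic_open_def)
    thus ?case using ab boolean_subalgebraD(4)[OF A ab(1,2)] by blast
  next
    case (UN K)
    then obtain S where "S \<in> K" "U \<in> S" by blast
    with UN(2)[OF this] show ?case by blast
  qed auto
  with U that show thesis by blast
qed

lemma continuous_map_indicator:
  assumes A: "boolean_subalgebra A" and a: "a \<in> A"
  shows "continuous_map (stone_space A) euclideanreal (\<lambda>U. of_bool (a \<in> U))"
  unfolding continuous_map
proof (intro conjI allI impI)
  fix V :: "real set" assume "openin euclideanreal V"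
  have "{U \<in> topspace (stone_space A). of_bool (a \<in> U) \<in> V} =
      (if 1 \<in> V then basic_open A a else {}) \<union> (if 0 \<in> V then basic_open A (- a) else {})"
    unfolding topspace_stone_space[OF A] using ultrafilterD(5)[OF A _ a] by (auto simp: basic_open_def)
  thus "openin (stone_space A) {U \<in> topspace (stone_space A). of_bool (a \<in> U) \<in> V}"
    using openin_basic_open a boolean_subalgebraD(3)[OF A a] by auto
qed simp

text \<open>
  The ultrafilters correspond to the points of the power \<open>{False, True}\<close> over \<open>A\<close> that satisfy conditions
  on at most three coordinates each; such conditions are closed, so Tychonoff's theorem applies.
\<close>
lemma compact_space_stone_space:
  fixes A :: "'a::boolean_algebra set"
  assumes A: "boolean_subalgebra A"
  shows "compact_space (stone_space A)"
proof -
  note cl = boolean_subalgebraD[OF A]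
  define P where "P = product_topology (\<lambda>_. discrete_topology (UNIV :: bool set)) A"
  define E where "E = (\<lambda>Q. {f \<in> topspace P. Q f})"
  define S where "S = E (\<lambda>f. f top) \<inter> E (\<lambda>f. \<not> f bot) \<inter>
     (\<Inter>a\<in>A. \<Inter>b\<in>A. E (\<lambda>f. f a \<and> f b \<longrightarrow> f (inf a b))) \<inter>
     (\<Inter>a\<in>A. \<Inter>b\<in>A. E (\<lambda>f. a \<le> b \<and> f a \<longrightarrow> f b)) \<inter> (\<Inter>a\<in>A. E (\<lambda>f. f a \<or> f (- a)))"
  have ev: "closedin P (E (\<lambda>f. f a))" "closedin P (E (\<lambda>f. \<not> f a))" if "a \<in> A" for a
  proof -
    have "continuous_map P (discrete_topology UNIV) (\<lambda>f. f a)"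
      unfolding P_def by (rule continuous_map_product_projection[OF that])
    from closedin_continuous_map_preimage[OF this, of "{True}"] closedin_continuous_map_preimage[OF this, of "{False}"]
    show "closedin P (E (\<lambda>f. f a))" "closedin P (E (\<lambda>f. \<not> f a))" by (simp_all add: E_def)
  qed
  have dis: "closedin P (E (\<lambda>f. Q f \<or> R f))" if "closedin P (E Q)" "closedin P (E R)" for Q R
  proof -
    have "E (\<lambda>f. Q f \<or> R f) = E Q \<union> E R" by (auto simp: E_def)
    thus ?thesis using closedin_Un[OF that] by simp
  qed
  have triv: "closedin P (E (\<lambda>f. b))" for b :: bool by (cases b) (simp_all add: E_def)
  have ne: "A \<noteq> {}" using cl(1) by blast
  have "closedin P S"
    unfolding S_def imp_conv_disj de_Morgan_conj
    by (intro closedin_Int closedin_INT ne dis ev triv cl) 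
  hence "compactin P S"
    by (intro closedin_compact_space) (simp_all add: P_def compact_space_product_topology compact_space_discrete_topology)
  moreover define g where "g = (\<lambda>f. {a \<in> A. f a})"
  have gS: "g ` S = ultrafilters A"
  proof (intro subset_antisym subsetI)
    fix U assume "U \<in> g ` S"
    then obtain f where f: "f \<in> S" "U = g f" by blast
    have QE: "Q f" if "f \<in> E Q" for Q using that by (simp add: E_def)
    have t: "f top" by (rule QE[of "\<lambda>f. f top"]) (use f(1) in \<open>simp only: S_def Int_iff\<close>)
    have b: "\<not> f bot"
      by (rule QE[of "\<lambda>f. \<not> f bot"]) (use f(1) in \<open>simp only: S_def Int_iff\<close>)
    have i: "f a \<and> f b \<longrightarrow> f (inf a b)" if "a \<in> A" "b \<in> A" for a b
      by (rule QE[of "\<lambda>f. f a \<and> f b \<longrightarrow> f (inf a b)"]) (use f(1) that in \<open>simp only: S_def Int_iff INT_iff\<close>)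
    have l: "a \<le> b \<and> f a \<longrightarrow> f b" if "a \<in> A" "b \<in> A" for a b
      by (rule QE[of "\<lambda>f. a \<le> b \<and> f a \<longrightarrow> f b"]) (use f(1) that in \<open>simp only: S_def Int_iff INT_iff\<close>)
    have n: "f a \<or> f (- a)" if "a \<in> A" for a
      by (rule QE[of "\<lambda>f. f a \<or> f (- a)"]) (use f(1) that in \<open>simp only: S_def Int_iff INT_iff\<close>)
    show "U \<in> ultrafilters A"
      unfolding f(2) ultrafilters_def mem_Collect_eq
    proof (intro conjI ballI impI)
      fix a b assume "a \<in> g f" "b \<in> g f"
      thus "inf a b \<in> g f" using i[of a b] cl(4)[of a b] by (simp add: g_def)
    next
      fix a b assume "a \<in> g f" "b \<in> A" "a \<le> b"
      thus "b \<in> g f" using l[of a b] by (simp add: g_def)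
    next
      fix a assume "a \<in> A"
      thus "a \<in> g f \<or> - a \<in> g f" using n[of a] cl(3)[of a] by (simp add: g_def)
    qed (use t b cl(2) in \<open>auto simp: g_def\<close>)
  next
    fix U assume U: "U \<in> ultrafilters A"
    note UD = ultrafilterD[OF A U]
    have "restrict (\<lambda>a. a \<in> U) A \<in> S"
      unfolding S_def E_def P_def using cl UD by (auto simp: ne)
    moreover have "g (restrict (\<lambda>a. a \<in> U) A) = U" using UD(1) by (auto simp: g_def)
    ultimately show "U \<in> g ` S" by (metis imageI)
  qed
  have "continuous_map (subtopology P S) (stone_space A) g"
    unfolding stone_space_basic
  proof (rule continuous_on_generated_topo)
    have top: "topspace (subtopology P S) = S" by (auto simp: S_def E_def)
    fix W assume "W \<in> basic_open A ` A"
    then obtain a where a: "a \<in> A" "W = basic_open A a" by blast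
    have "g -` W \<inter> topspace (subtopology P S) = S \<inter> E (\<lambda>f. f a)"
      using gS a by (auto simp: top basic_open_def g_def S_def E_def image_subset_iff)
    moreover have "openin P (E (\<lambda>f. f a))"
    proof -
      have "E (\<lambda>f. f a) = topspace P - E (\<lambda>f. \<not> f a)" by (auto simp: E_def)
      thus ?thesis using ev(2)[OF a(1)] by auto
    qed
    ultimately show "openin (subtopology P S) (g -` W \<inter> topspace (subtopology P S))"
      by (metis inf_commute openin_subtopology_Int)
  next
    show "g ` topspace (subtopology P S) \<subseteq> \<Union> (basic_open A ` A)"
      using gS topspace_stone_space[OF A] unfolding stone_space_basic topology_generated_by_topspace
      by auto
  qed
  moreover have "compact_space (subtopology P S)" using calculation by (simp add: compact_space_subtopology)
  ultimately have "compactin (stone_space A) (g ` topspace (subtopology P S))"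
    using image_compactin compact_space_def by blast
  moreover have "topspace (subtopology P S) = S" by (auto simp: S_def E_def)
  ultimately show ?thesis using gS by (simp add: compact_space_def topspace_stone_space[OF A])
qed

definition principal :: "'x set set \<Rightarrow> 'x \<Rightarrow> 'x set set" where
  "principal A m = {a \<in> A. m \<in> a}"

lemma principal_ultrafilter:
  assumes A: "boolean_subalgebra A"
  shows "principal A m \<in> ultrafilters A"
  using boolean_subalgebraD[OF A] by (auto simp: principal_def ultrafilters_def)

lemma separable_space_stone_space:
  fixes A :: "'x::countable set set"
  assumes A: "boolean_subalgebra A"
  shows "separable_space (stone_space A)"
  unfolding separable_space_def
proof (intro exI conjI)
  show "countable (range (principal A))" by simp
  show sub: "range (principal A) \<subseteq> topspace (stone_space A)"
    using principal_ultrafilter[OF A] by (auto simp: topspace_stone_space[OF A])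
  show "stone_space A closure_of range (principal A) = topspace (stone_space A)"
    unfolding dense_intersects_open
  proof (intro allI impI)
    fix T assume T: "openin (stone_space A) T \<and> T \<noteq> {}"
    then obtain U where "U \<in> T" by blast
    then obtain a where a: "a \<in> A" "U \<in> basic_open A a" "basic_open A a \<subseteq> T"
      using basic_open_base[OF A] T by blast
    have "a \<noteq> {}" using a(2) ultrafilterD(3)[OF A] by (auto simp: basic_open_def)
    then obtain m where "m \<in> a" by blast
    hence "principal A m \<in> basic_open A a"
      using principal_ultrafilter[OF A] a(1) by (auto simp: basic_open_def principal_def)
    thus "range (principal A) \<inter> T \<noteq> {}" using a(3) by blast
  qed
qed

section \<open>The branch algebra\<close>

text \<open>
  Natural numbers encode pairs of a node \<open>u\<close> of the tree of finite sequences and a label \<open>q\<close>. The binary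
  digits of the labels make the points over one node a dense subset of a Cantor set, in which the
  \<open>i\<close>-th digit gives the \<open>i\<close>-th of a sequence of independent clopen sets.
\<close>
definition node :: "nat \<Rightarrow> nat list" where "node m = fst (from_nat m :: nat list \<times> nat)"
definition label :: "nat \<Rightarrow> nat" where "label m = snd (from_nat m :: nat list \<times> nat)"
definition point :: "nat list \<Rightarrow> nat \<Rightarrow> nat" where "point u q = to_nat (u, q)"

lemma node_point [simp]: "node (point u q) = u" and label_point [simp]: "label (point u q) = q"
  by (simp_all add: node_def label_def point_def)

definition stem :: "(nat \<Rightarrow> nat) \<Rightarrow> nat \<Rightarrow> nat list" where "stem \<sigma> n = map \<sigma> [0..<n]"

lemma length_stem [simp]: "length (stem \<sigma> n) = n" by (simp add: stem_def)
lemma take_stem: "take l (stem \<sigma> n) = stem \<sigma> (min l n)"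
  by (simp add: stem_def take_map min_def)
lemma stem_eq_iff: "stem \<sigma> n = stem \<tau> n \<longleftrightarrow> (\<forall>i<n. \<sigma> i = \<tau> i)"
  by (auto simp: stem_def)
lemma stem_Suc: "stem \<sigma> (Suc n) = stem \<sigma> n @ [\<sigma> n]"
  by (simp add: stem_def)

definition cone :: "nat list \<Rightarrow> nat set" where "cone u = {m. take (length u) (node m) = u}"
definition box :: "nat list \<Rightarrow> nat \<Rightarrow> nat \<Rightarrow> nat set" where
  "box u k r = {m. node m = u \<and> take_bit k (label m) = r}"
text \<open>
  Over the node \<open>stem \<sigma> n\<close> the set \<open>branch \<sigma>\<close> consists of the labels whose digit number \<open>\<sigma> n\<close> is 1. Branches
  through different children of one node thus select independent sets over that node, while \<open>branch \<sigma>\<close> is new to the algebra of cones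
  and boxes only at the end of the infinite branch \<open>\<sigma>\<close>.
\<close>
definition branch :: "(nat \<Rightarrow> nat) \<Rightarrow> nat set" where
  "branch \<sigma> = {m. node m = stem \<sigma> (length (node m)) \<and> bit (label m) (\<sigma> (length (node m)))}"

definition tree_sets :: "nat set set" where
  "tree_sets = range cone \<union> {box u k r |u k r. True}"

abbreviation tree_algebra :: "nat set set" where
  "tree_algebra \<equiv> algebra_generated_by tree_sets"

definition branch_algebra :: "nat set set" where
  "branch_algebra = algebra_generated_by (tree_sets \<union> range branch)"

lemma cone_in: "cone u \<in> tree_sets" and box_in: "box u k r \<in> tree_sets"
  unfolding tree_sets_def by blast+

lemma tree_setsE:
  assumes "x \<in> tree_sets"
  obtains (cone) u where "x = cone u" | (box) u k r where "x = box u k r"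
  using assms unfolding tree_sets_def by blast

lemma subalgebra_finite_UN:
  fixes a :: "'i \<Rightarrow> 'x set"
  assumes B: "boolean_subalgebra B" and "finite I" "\<And>i. i \<in> I \<Longrightarrow> a i \<in> B"
  shows "(\<Union>i\<in>I. a i) \<in> B"
  using assms(2,3) boolean_subalgebraD(1,5)[OF B] by (induction I) auto

lemma tree_sets_laminar:
  assumes x: "x \<in> tree_sets" and y: "y \<in> tree_sets"
  shows "inf x y \<in> {bot, x, y}"
proof -
  have cc: "cone u \<inter> cone v \<in> {{}, cone u, cone v}" for u v
  proof -
    have "cone u \<inter> cone v \<in> {{}, cone u, cone v}" if l: "length u \<le> length v" for u v
    proof (cases "take (length u) v = u")
      case True
      have "cone v \<subseteq> cone u"
      proof
        fix m assume "m \<in> cone v"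
        hence "take (length u) (node m) = take (length u) v"
          using l unfolding cone_def mem_Collect_eq by (metis min.absorb1 take_take)
        with True show "m \<in> cone u" by (simp add: cone_def)
      qed
      thus ?thesis by blast
    next
      case False
      have "m \<notin> cone u \<inter> cone v" for m
      proof
        assume "m \<in> cone u \<inter> cone v"
        hence "take (length u) (node m) = u" "take (length v) (node m) = v" by (auto simp: cone_def)
        with l False show False by (metis min.absorb1 take_take)
      qed
      thus ?thesis by blast
    qed
    from this[of u v] this[of v u] show ?thesis by (cases "length u \<le> length v") (auto simp: Int_commute)
  qed
  have cb: "cone u \<inter> box v k r \<in> {{}, box v k r}" for u v k r
    by (cases "take (length u) v = u") (auto simp: cone_def box_def)
  have bb: "box u k r \<inter> box v l t \<in> {{}, box u k r, box v l t}" for u v k r l t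
  proof -
    have "box u k r \<inter> box v l t \<in> {{}, box u k r, box v l t}" if "k \<le> l" for u v k r l t
    proof (cases "u = v \<and> take_bit k t = r")
      case True
      have "box v l t \<subseteq> box u k r"
      proof
        fix m assume "m \<in> box v l t"
        hence "node m = v" "take_bit l (label m) = t" by (auto simp: box_def)
        moreover from this(2) have "take_bit k (label m) = take_bit k t"
          using that by (auto simp: min_def)
        ultimately show "m \<in> box u k r" using True by (simp add: box_def)
      qed
      thus ?thesis by blast
    next
      case False
      have "m \<notin> box u k r \<inter> box v l t" for m
      proof
        assume m: "m \<in> box u k r \<inter> box v l t"
        hence "take_bit k (take_bit l (label m)) = take_bit k t" by (simp add: box_def)
        hence "take_bit k (label m) = take_bit k t" using that by (simp add: min_def)
        thus False using m False by (auto simp: box_def)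
      qed
      thus ?thesis by blast
    qed
    from this[of k l u r v t] this[of l k v t u r] show ?thesis by (cases "k \<le> l") (auto simp: Int_commute)
  qed
  from x y show ?thesis
  proof (cases rule: tree_setsE[case_product tree_setsE])
    case (cone_box u v k r) thus ?thesis using cb[of u v k r] by auto
  next
    case (box_cone u k r v) thus ?thesis using cb[of v u k r] by (auto simp: Int_commute)
  next
    case (cone_cone u v) thus ?thesis using cc[of u v] by simp
  next
    case (box_box u k r v l t) thus ?thesis using bb[of u k r v l t] by simp
  qed
qed

text \<open>
  There are only finitely many values of the first \<open>k\<close> digits, so a condition on them is a finite
  union of boxes.
\<close>
lemma slice_in_tree_algebra: "{m. node m = u \<and> P (take_bit k (label m))} \<in> tree_algebra"
proof -
  have "{m. node m = u \<and> P (take_bit k (label m))} = (\<Union>r\<in>{r. r < 2 ^ k \<and> P r}. box u k r)"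
    by (auto simp: box_def)
  moreover have "(\<Union>r\<in>{r. r < 2 ^ k \<and> P r}. box u k r) \<in> tree_algebra"
    by (rule subalgebra_finite_UN[OF boolean_subalgebra_generated]) (auto intro: hull_inc box_in)
  ultimately show ?thesis by simp
qed

definition truncated_branch :: "(nat \<Rightarrow> nat) \<Rightarrow> nat \<Rightarrow> nat set" where
  "truncated_branch \<sigma> n = {m \<in> branch \<sigma>. length (node m) < n}"

lemma truncated_branch_in_tree_algebra: "truncated_branch \<sigma> n \<in> tree_algebra"
proof -
  have "truncated_branch \<sigma> n =
      (\<Union>i<n. {m. node m = stem \<sigma> i \<and> bit (take_bit (Suc (\<sigma> i)) (label m)) (\<sigma> i)})"
    by (auto simp: truncated_branch_def branch_def bit_take_bit_iff)
  thus ?thesis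
    using subalgebra_finite_UN[OF boolean_subalgebra_generated finite_lessThan slice_in_tree_algebra] by simp
qed

lemma truncated_branch_cong:
  assumes "\<And>i. i < n \<Longrightarrow> \<sigma> i = \<tau> i"
  shows "truncated_branch \<sigma> n = truncated_branch \<tau> n"
proof -
  have "m \<in> truncated_branch \<sigma> n \<Longrightarrow> m \<in> truncated_branch \<tau> n"
    if "\<And>i. i < n \<Longrightarrow> \<sigma> i = \<tau> i" for \<sigma> \<tau> m
    unfolding truncated_branch_def branch_def
    using that stem_eq_iff[of \<sigma> "length (node m)" \<tau>] by auto
  from this[of \<sigma> \<tau>] this[of \<tau> \<sigma>] assms show ?thesis by auto
qed

lemma branch_Int_cone:
  "branch \<sigma> \<inter> cone u = (if stem \<sigma> (length u) = u then branch \<sigma> - truncated_branch \<sigma> (length u) else {})"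
proof -
  have "m \<in> cone u \<longleftrightarrow> stem \<sigma> (length u) = u \<and> \<not> length (node m) < length u" if "m \<in> branch \<sigma>" for m
  proof -
    have "node m = stem \<sigma> (length (node m))" using that by (simp add: branch_def)
    hence *: "m \<in> cone u \<longleftrightarrow> stem \<sigma> (min (length u) (length (node m))) = u"
      unfolding cone_def mem_Collect_eq by (metis take_stem)
    show ?thesis
    proof
      assume "m \<in> cone u"
      hence s: "stem \<sigma> (min (length u) (length (node m))) = u" using * by simp
      hence "min (length u) (length (node m)) = length u" by (metis length_stem)
      with s show "stem \<sigma> (length u) = u \<and> \<not> length (node m) < length u" by auto
    qed (simp add: * min_def)
  qed
  thus ?thesis by (auto simp: truncated_branch_def)
qed

text \<open>
  A cone that does not contain the end of the branch \<open>\<sigma>\<close> meets \<open>branch \<sigma>\<close> in the empty set, and one that contains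
  it misses only finitely many nodes of the branch. Two distinct branches have finitely many nodes in
  common. So \<open>branch \<sigma>\<close> splits only the ultrafilter of all cones along \<open>\<sigma>\<close>.
\<close>
lemma branch_splits:
  assumes b: "b \<in> tree_sets \<union> range branch" "b \<noteq> branch \<sigma>"
  shows "branch \<sigma> \<inter> b \<in> tree_algebra \<or> branch \<sigma> \<inter> - b \<in> tree_algebra"
  using b(1)
proof
  assume "b \<in> tree_sets"
  thus ?thesis
  proof (cases rule: tree_setsE)
    case (cone u)
    have "branch \<sigma> \<inter> - cone u = branch \<sigma> - branch \<sigma> \<inter> cone u" by blast
    hence "branch \<sigma> \<inter> cone u = {} \<or> branch \<sigma> \<inter> - cone u = truncated_branch \<sigma> (length u)"
      by (auto simp: branch_Int_cone truncated_branch_def)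
    thus ?thesis using truncated_branch_in_tree_algebra generated_closed(1)[of tree_sets] cone by auto
  next
    case (box u k r)
    let ?l = "length u" let ?K = "max k (Suc (\<sigma> (length u)))"
    have "branch \<sigma> \<inter> box u k r = (if stem \<sigma> ?l = u
        then {m. node m = u \<and> bit (take_bit ?K (label m)) (\<sigma> ?l) \<and> take_bit k (take_bit ?K (label m)) = r}
        else {})"
      by (auto simp: branch_def box_def bit_take_bit_iff)
    also have "\<dots> \<in> tree_algebra"
      using slice_in_tree_algebra[of u "\<lambda>q. bit q (\<sigma> ?l) \<and> take_bit k q = r" ?K]
        generated_closed(1)[of tree_sets] by simp
    finally show ?thesis using box by simp
  qed
next
  assume "b \<in> range branch"
  then obtain \<tau> where \<tau>: "b = branch \<tau>" by blast
  with b(2) have "\<sigma> \<noteq> \<tau>" by blast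
  then obtain n where n: "\<sigma> n \<noteq> \<tau> n" by (meson ext)
  have "length (node m) < Suc n" if "m \<in> branch \<sigma>" "m \<in> branch \<tau>" for m
  proof -
    have "stem \<sigma> (length (node m)) = stem \<tau> (length (node m))" using that by (simp add: branch_def)
    hence "\<not> n < length (node m)" using n by (auto simp: stem_eq_iff)
    thus ?thesis by simp
  qed
  hence "branch \<sigma> \<inter> b = truncated_branch \<sigma> (Suc n) \<inter> truncated_branch \<tau> (Suc n)"
    by (auto simp: \<tau> truncated_branch_def)
  also have "\<dots> \<in> tree_algebra"
    using generated_closed(4)[OF truncated_branch_in_tree_algebra truncated_branch_in_tree_algebra] by simp
  finally show ?thesis by simp
qed

theorem minimally_generated_branch_algebra: "minimally_generated branch_algebra"
  unfolding branch_algebra_def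
proof (rule minimally_generated_two_layers)
  fix x b assume "x \<in> range branch" "b \<in> tree_sets \<union> range branch" "b \<noteq> x"
  thus "inf x b \<in> tree_algebra \<or> inf x (- b) \<in> tree_algebra"
    using branch_splits by auto
qed (rule tree_sets_laminar)

lemma branch_algebra_subalgebra: "boolean_subalgebra branch_algebra"
  unfolding branch_algebra_def by (rule boolean_subalgebra_generated)

lemma in_branch_algebra: "cone u \<in> branch_algebra" "box u k r \<in> branch_algebra" "branch \<sigma> \<in> branch_algebra"
  "truncated_branch \<sigma> n \<in> branch_algebra"
proof -
  have "tree_algebra \<subseteq> branch_algebra" unfolding branch_algebra_def by (rule hull_mono) simp
  thus "truncated_branch \<sigma> n \<in> branch_algebra" using truncated_branch_in_tree_algebra by blast
qed (auto simp: branch_algebra_def intro!: hull_inc cone_in box_in)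

definition determined_by_bits :: "nat list \<Rightarrow> nat \<Rightarrow> nat set \<Rightarrow> bool" where
  "determined_by_bits u k a \<longleftrightarrow> (\<forall>m m'. node m = u \<longrightarrow> node m' = u \<longrightarrow>
     take_bit k (label m) = take_bit k (label m') \<longrightarrow> (m \<in> a \<longleftrightarrow> m' \<in> a))"

lemma determined_by_bits_mono:
  assumes a: "determined_by_bits u k a" and kl: "k \<le> l"
  shows "determined_by_bits u l a"
  unfolding determined_by_bits_def
proof (intro allI impI)
  fix m m' assume m: "node m = u" "node m' = u" "take_bit l (label m) = take_bit l (label m')"
  have "take_bit k (label m) = take_bit k (take_bit l (label m))" using kl by (simp add: min_def)
  also have "\<dots> = take_bit k (label m')" using kl m(3) by (simp add: min_def)
  finally show "m \<in> a \<longleftrightarrow> m' \<in> a" using a m unfolding determined_by_bits_def by blast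
qed

text \<open>
  Over a fixed node, each set of the algebra is clopen for the topology of the digits; \<open>branch \<sigma>\<close> depends
  there on a single digit.
\<close>
lemma branch_algebra_determined_by_bits:
  assumes "a \<in> branch_algebra"
  shows "\<exists>k. determined_by_bits u k a"
proof -
  have "branch_algebra \<subseteq> {a. \<exists>k. determined_by_bits u k a}"
    unfolding branch_algebra_def
  proof (rule hull_minimal)
    show "boolean_subalgebra {a. \<exists>k. determined_by_bits u k a}"
    proof (rule boolean_subalgebraI)
      fix a b assume "a \<in> {a. \<exists>k. determined_by_bits u k a}" "b \<in> {a. \<exists>k. determined_by_bits u k a}"
      then obtain k l where "determined_by_bits u k a" "determined_by_bits u l b" by blast
      hence "determined_by_bits u (max k l) a" "determined_by_bits u (max k l) b" by (simp_all add: determined_by_bits_mono)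
      hence "determined_by_bits u (max k l) (inf a b)" "determined_by_bits u (max k l) (sup a b)"
        unfolding determined_by_bits_def Int_iff Un_iff by blast+
      thus "inf a b \<in> {a. \<exists>k. determined_by_bits u k a}" "sup a b \<in> {a. \<exists>k. determined_by_bits u k a}" by blast+
    qed (simp_all add: determined_by_bits_def)
    have "determined_by_bits u 0 (cone v)" for v by (simp add: determined_by_bits_def cone_def)
    moreover have "determined_by_bits u k (box v k r)" for v k r by (simp add: determined_by_bits_def box_def)
    moreover have "determined_by_bits u (Suc (\<sigma> (length u))) (branch \<sigma>)" for \<sigma>
    proof -
      have "bit q (\<sigma> (length u)) \<longleftrightarrow> bit (take_bit (Suc (\<sigma> (length u))) q) (\<sigma> (length u))" for q :: nat
        by (simp add: bit_take_bit_iff)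
      thus ?thesis unfolding determined_by_bits_def branch_def mem_Collect_eq by metis
    qed
    ultimately show "tree_sets \<union> range branch \<subseteq> {a. \<exists>k. determined_by_bits u k a}"
      unfolding tree_sets_def by blast
  qed
  with assms show ?thesis by blast
qed

text \<open>
  Hence near a principal ultrafilter the Stone space can be explored through the boxes over one node.
\<close>
lemma box_neighbourhood:
  assumes W: "openin (stone_space branch_algebra) W" and m: "principal branch_algebra (point u q) \<in> W"
  obtains k where "basic_open branch_algebra (box u k (take_bit k q)) \<subseteq> W"
proof -
  let ?A = branch_algebra
  note sub = branch_algebra_subalgebra
  obtain a where a: "a \<in> ?A" "principal ?A (point u q) \<in> basic_open ?A a" "basic_open ?A a \<subseteq> W"
    using basic_open_base[OF sub W m] by blast
  obtain k where k: "determined_by_bits u k a" using branch_algebra_determined_by_bits[OF a(1)] by blast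
  have "point u q \<in> a" using a(2) by (simp add: basic_open_def principal_def)
  have "box u k (take_bit k q) \<subseteq> a"
  proof
    fix m assume "m \<in> box u k (take_bit k q)"
    hence "node m = u" "take_bit k (label m) = take_bit k (label (point u q))" by (auto simp: box_def)
    with k \<open>point u q \<in> a\<close> show "m \<in> a" unfolding determined_by_bits_def using node_point by blast
  qed
  hence "basic_open ?A (box u k (take_bit k q)) \<subseteq> basic_open ?A a"
    using ultrafilterD(4)[OF sub _ _ a(1)] by (auto simp: basic_open_def)
  with a(3) show thesis by (intro that) blast
qed

section \<open>The Stone space is Rosenthal compact\<close>

definition baire_space :: "(nat \<Rightarrow> nat) topology" where
  "baire_space = product_topology (\<lambda>_. discrete_topology UNIV) UNIV"

lemma topspace_baire_space [simp]: "topspace baire_space = UNIV"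
  by (simp add: baire_space_def)

lemma openin_baire_space:
  assumes "\<And>x. x \<in> S \<Longrightarrow> \<exists>n. \<forall>x'. (\<forall>i<n. x' i = x i) \<longrightarrow> x' \<in> S"
  shows "openin baire_space S"
  unfolding baire_space_def openin_product_topology_alt
proof (intro conjI ballI)
  fix x assume "x \<in> S"
  then obtain n where n: "\<forall>x'. (\<forall>i<n. x' i = x i) \<longrightarrow> x' \<in> S" using assms by blast
  define V where "V = (\<lambda>i. if i < n then {x i} else UNIV)"
  show "\<exists>V. finite {i \<in> UNIV. V i \<noteq> topspace (discrete_topology (UNIV :: nat set))} \<and>
      (\<forall>i\<in>UNIV. openin (discrete_topology (UNIV :: nat set)) (V i)) \<and> x \<in> Pi\<^sub>E UNIV V \<and> Pi\<^sub>E UNIV V \<subseteq> S"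
  proof (intro exI[of _ V] conjI ballI)
    show "finite {i \<in> UNIV. V i \<noteq> topspace (discrete_topology (UNIV :: nat set))}"
      by (rule finite_subset[of _ "{..<n}"]) (auto simp: V_def)
    show "Pi\<^sub>E UNIV V \<subseteq> S"
    proof
      fix x' assume "x' \<in> Pi\<^sub>E UNIV V"
      hence "x' i \<in> V i" for i by (simp add: PiE_iff)
      hence "\<forall>i<n. x' i = x i" by (metis V_def singletonD)
      thus "x' \<in> S" using n by blast
    qed
  qed (auto simp: V_def)
qed

lemma continuous_map_baire_spaceI:
  assumes "\<And>x x'. (\<And>i. i < n \<Longrightarrow> x' i = x i) \<Longrightarrow> h x' = h x"
  shows "continuous_map baire_space euclideanreal h"
  unfolding continuous_map
proof (intro conjI allI impI)
  fix V :: "real set"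
  show "openin baire_space {x \<in> topspace baire_space. h x \<in> V}"
    by (rule openin_baire_space) (use assms in \<open>metis (mono_tags, lifting) UNIV_I mem_Collect_eq topspace_baire_space\<close>)
qed simp

lemma polish_baire_space: "polish_topology baire_space"
  unfolding polish_topology_def
proof
  show "completely_metrizable_space baire_space"
    unfolding baire_space_def completely_metrizable_space_product_topology
    by (simp add: completely_metrizable_space_discrete_topology)
  define ev where "ev = (\<lambda>(l :: nat list) i. if i < length l then l ! i else 0)"
  show "separable_space baire_space"
    unfolding separable_space_def
  proof (intro exI conjI)
    show "countable (range ev)" by simp
    show "baire_space closure_of range ev = topspace baire_space"
      unfolding dense_intersects_open
    proof (intro allI impI)
      fix T assume T: "openin baire_space T \<and> T \<noteq> {}"
      then obtain x where x: "x \<in> T" by blast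
      then obtain V where V: "finite {i. V i \<noteq> (UNIV :: nat set)}" "x \<in> Pi\<^sub>E UNIV V" "Pi\<^sub>E UNIV V \<subseteq> T"
        using T unfolding baire_space_def openin_product_topology_alt by fastforce
      obtain n where n: "{i. V i \<noteq> UNIV} \<subseteq> {..<n}"
        using V(1) finite_nat_iff_bounded by blast
      have "ev (map x [0..<n]) i \<in> V i" for i
      proof (cases "i < n")
        case True thus ?thesis using V(2) by (auto simp: ev_def)
      next
        case False
        hence "V i = UNIV" using n by auto
        thus ?thesis by simp
      qed
      hence "ev (map x [0..<n]) \<in> Pi\<^sub>E UNIV V" by (simp add: PiE_iff)
      thus "range ev \<inter> T \<noteq> {}" using V(3) by blast
    qed
  qed simp
qed

lemma baire_space_real_code:
  obtains e :: "(nat \<Rightarrow> nat) \<Rightarrow> real" where "inj e"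
proof -
  obtain b :: "nat set \<Rightarrow> real" where b: "inj b"
    using nat_sets_eqpoll_reals unfolding eqpoll_def bij_betw_def by blast
  define G where "G = (\<lambda>(x :: nat \<Rightarrow> nat). range (\<lambda>n. to_nat (n, x n)))"
  have "inj G"
  proof (rule injI, rule ext)
    fix x y :: "nat \<Rightarrow> nat" and n assume "G x = G y"
    hence "to_nat (n, x n) \<in> G y" by (auto simp: G_def)
    thus "x n = y n" by (auto simp: G_def)
  qed
  with b have "inj (b \<circ> G)" by (rule inj_compose)
  thus thesis by (rule that)
qed

text \<open>
  The Polish space is the Baire space, carried over to a set of reals by an injective coding. On a
  compact space a continuous injection into a Hausdorff space is an embedding.
\<close>
lemma rosenthal_compactI:
  assumes K: "compact_space K"
    and cont: "\<And>x. continuous_map K euclideanreal (\<lambda>p. h p x)"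
    and sep: "\<And>p q. p \<in> topspace K \<Longrightarrow> q \<in> topspace K \<Longrightarrow> (\<And>x. h p x = h q x) \<Longrightarrow> p = q"
    and b1: "\<And>p. p \<in> topspace K \<Longrightarrow> \<exists>g :: nat \<Rightarrow> (nat \<Rightarrow> nat) \<Rightarrow> real.
      (\<forall>n. continuous_map baire_space euclideanreal (g n)) \<and> (\<forall>x. (\<lambda>n. g n x) \<longlonglongrightarrow> h p x)"
  shows "rosenthal_compact K"
proof -
  obtain e :: "(nat \<Rightarrow> nat) \<Rightarrow> real" where e: "inj e" using baire_space_real_code .
  define X where "X = pullback_topology (range e) (inv e) baire_space"
  have topX: "topspace X = range e" by (simp add: X_def topspace_pullback_topology)
  have inv_e: "inv e (e x) = x" for x using e by simp
  have "continuous_map baire_space X e"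
    unfolding X_def by (rule continuous_map_pullback') (auto simp: o_def inv_e)
  moreover have decode: "continuous_map X baire_space (inv e)"
    using continuous_map_pullback[OF continuous_map_id, of "range e" "inv e" baire_space]
    by (simp add: X_def)
  ultimately have "homeomorphic_maps baire_space X e (inv e)"
    by (auto simp: homeomorphic_maps_def topX inv_e)
  hence "baire_space homeomorphic_space X" unfolding homeomorphic_space_def by blast
  hence polish: "polish_topology X"
    using polish_baire_space homeomorphic_separable_space homeomorphic_completely_metrizable_space
    unfolding polish_topology_def by blast
  define f where "f = (\<lambda>p. restrict (\<lambda>r. h p (inv e r)) (range e))"
  have "continuous_map K (baire_one_space X) f"
    unfolding baire_one_space_def continuous_map_in_subtopology continuous_map_componentwise topX
  proof (intro conjI ballI)
    show "f ` topspace K \<subseteq> extensional (range e)" by (auto simp: f_def)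
    fix r assume "r \<in> range e"
    thus "continuous_map K euclideanreal (\<lambda>p. f p r)" using cont by (simp add: f_def)
  next
    show "f \<in> topspace K \<rightarrow> {f. \<exists>g. (\<forall>n. continuous_map X euclideanreal (g n)) \<and>
        (\<forall>x\<in>range e. (\<lambda>n. g n x) \<longlonglongrightarrow> f x)}"
    proof (intro funcsetI CollectI)
      fix p assume "p \<in> topspace K"
      then obtain g where g: "\<And>n. continuous_map baire_space euclideanreal (g n)"
          "\<And>x. (\<lambda>n. g n x) \<longlonglongrightarrow> h p x" using b1 by blast
      have "continuous_map X euclideanreal (g n \<circ> inv e)" for n
        using decode g(1) by (rule continuous_map_compose)
      thus "\<exists>g. (\<forall>n. continuous_map X euclideanreal (g n)) \<and> (\<forall>x\<in>range e. (\<lambda>n. g n x) \<longlonglongrightarrow> f p x)"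
        using g(2) by (intro exI[of _ "\<lambda>n. g n \<circ> inv e"]) (simp add: f_def)
    qed
  qed
  moreover have "inj_on f (topspace K)"
  proof (rule inj_onI)
    fix p q assume pq: "p \<in> topspace K" "q \<in> topspace K" "f p = f q"
    have "h p x = h q x" for x using fun_cong[OF pq(3), of "e x"] by (simp add: f_def inv_e)
    thus "p = q" using sep pq by blast
  qed
  moreover have "Hausdorff_space (baire_one_space X)"
    unfolding baire_one_space_def
    by (intro Hausdorff_space_subtopology) (simp add: Hausdorff_space_product_topology)
  ultimately have "embedding_map K (baire_one_space X) f"
    using continuous_imp_embedding_map K by blast
  thus ?thesis unfolding rosenthal_compact_def using K polish by blast
qed

text \<open>
  As a function of \<open>\<sigma>\<close>, the statement \<open>branch \<sigma> \<in> U\<close> is a limit of statements on the first \<open>n\<close> terms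
  of \<open>\<sigma>\<close>. If some cone along \<open>\<sigma>\<close> is not in \<open>U\<close>, then the part of the branch beyond it does not matter.
  At most one \<open>\<sigma>\<close> has all its cones in \<open>U\<close>, and the constant \<open>c\<close> records the correct value for that one.
\<close>
lemma branch_baire_one:
  assumes U: "U \<in> ultrafilters branch_algebra"
  defines "c \<equiv> \<exists>\<tau>. (\<forall>n. cone (stem \<tau> n) \<in> U) \<and> branch \<tau> \<in> U"
  shows "\<exists>n0. \<forall>n\<ge>n0. (truncated_branch \<sigma> n \<in> U \<or> cone (stem \<sigma> n) \<in> U \<and> c) \<longleftrightarrow> branch \<sigma> \<in> U"
proof -
  note UD = ultrafilterD[OF branch_algebra_subalgebra U]
  have split: "branch \<sigma> \<in> U \<longleftrightarrow> truncated_branch \<sigma> n \<in> U \<or> branch \<sigma> \<in> U \<and> cone (stem \<sigma> n) \<in> U" for n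
  proof -
    have "branch \<sigma> = sup (truncated_branch \<sigma> n) (inf (branch \<sigma>) (cone (stem \<sigma> n)))"
      by (auto simp: branch_Int_cone truncated_branch_def)
    thus ?thesis
      using UD(7)[OF in_branch_algebra(4)[of \<sigma> n] boolean_subalgebraD(4)[OF branch_algebra_subalgebra in_branch_algebra(3,1)]]
        UD(6)[OF in_branch_algebra(3,1)] by metis
  qed
  show ?thesis
  proof (cases "\<forall>n. cone (stem \<sigma> n) \<in> U")
    case True
    have "truncated_branch \<sigma> n \<notin> U" for n
    proof
      assume "truncated_branch \<sigma> n \<in> U"
      hence "inf (truncated_branch \<sigma> n) (cone (stem \<sigma> n)) \<in> U"
        using True UD(6)[OF in_branch_algebra(4,1)] by simp
      moreover have "inf (truncated_branch \<sigma> n) (cone (stem \<sigma> n)) = bot"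
        using branch_Int_cone[of \<sigma> "stem \<sigma> n"] by (auto simp: truncated_branch_def)
      ultimately show False using UD(3) by simp
    qed
    moreover have "c \<longleftrightarrow> branch \<sigma> \<in> U"
    proof
      assume c
      then obtain \<tau> where \<tau>: "\<forall>n. cone (stem \<tau> n) \<in> U" "branch \<tau> \<in> U" unfolding c_def by blast
      have "\<sigma> n = \<tau> n" for n
      proof (rule ccontr)
        assume "\<sigma> n \<noteq> \<tau> n"
        hence "stem \<sigma> (Suc n) \<noteq> stem \<tau> (Suc n)" by (auto simp: stem_eq_iff)
        hence "inf (cone (stem \<sigma> (Suc n))) (cone (stem \<tau> (Suc n))) = bot" by (auto simp: cone_def)
        moreover have "inf (cone (stem \<sigma> (Suc n))) (cone (stem \<tau> (Suc n))) \<in> U"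
          using True \<tau>(1) UD(6)[OF in_branch_algebra(1,1)] by simp
        ultimately show False using UD(3) by simp
      qed
      with \<tau>(2) show "branch \<sigma> \<in> U" by (metis ext)
    qed (use True in \<open>auto simp: c_def\<close>)
    ultimately show ?thesis using True by simp
  next
    case False
    then obtain n0 where n0: "cone (stem \<sigma> n0) \<notin> U" by blast
    have "cone (stem \<sigma> n) \<notin> U" if "n \<ge> n0" for n
    proof
      assume c: "cone (stem \<sigma> n) \<in> U"
      have "cone (stem \<sigma> n) \<subseteq> cone (stem \<sigma> n0)"
      proof
        fix m assume "m \<in> cone (stem \<sigma> n)"
        hence "take n0 (take n (node m)) = take n0 (stem \<sigma> n)" by (simp add: cone_def)
        thus "m \<in> cone (stem \<sigma> n0)" using that by (simp add: cone_def take_stem min_def)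
      qed
      with c n0 show False using UD(4)[OF c in_branch_algebra(1)] by blast
    qed
    thus ?thesis using split by blast
  qed
qed

text \<open>
  An ultrafilter is determined by the generators that it contains. The generators are indexed by the
  Baire space: sequences that start with 0 stand for branches, and those that start with \<open>i + 1\<close> for the
  \<open>i\<close>-th set of the countable family of cones and boxes.
\<close>
theorem rosenthal_compact_branch_algebra: "rosenthal_compact (stone_space branch_algebra)"
proof -
  let ?A = branch_algebra
  note sub = branch_algebra_subalgebra
  have ct: "countable tree_sets"
  proof -
    have eq: "tree_sets = range cone \<union> range (\<lambda>(u, k, r). box u k r)"
      by (auto simp: tree_sets_def image_iff)
    show ?thesis unfolding eq by simp
  qed
  have ne: "tree_sets \<noteq> {}" using cone_in by blast
  define gen where "gen = (\<lambda>x :: nat \<Rightarrow> nat. if x 0 = 0 then branch (\<lambda>n. x (Suc n))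
      else from_nat_into tree_sets (x 0 - 1))"
  have gen_in: "gen x \<in> ?A" for x
    using from_nat_into[OF ne, of "x 0 - 1"] in_branch_algebra
    by (auto simp: gen_def elim: tree_setsE)
  have gen_surj: "\<exists>x. g = gen x" if g: "g \<in> tree_sets \<union> range branch" for g
    using g
  proof
    assume "g \<in> tree_sets"
    then obtain i where "from_nat_into tree_sets i = g" using from_nat_into_surj[OF ct] by blast
    thus ?thesis by (intro exI[of _ "\<lambda>_. Suc i"]) (simp add: gen_def)
  next
    assume "g \<in> range branch"
    then obtain \<sigma> where "g = branch \<sigma>" by blast
    thus ?thesis by (intro exI[of _ "\<lambda>n. case n of 0 \<Rightarrow> 0 | Suc i \<Rightarrow> \<sigma> i"]) (simp add: gen_def)
  qed
  show ?thesis
  proof (rule rosenthal_compactI[where h = "\<lambda>U x. of_bool (gen x \<in> U)"])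
    show "compact_space (stone_space ?A)" by (rule compact_space_stone_space[OF sub])
    show "continuous_map (stone_space ?A) euclideanreal (\<lambda>U. of_bool (gen x \<in> U))" for x
      by (rule continuous_map_indicator[OF sub gen_in])
  next
    fix U V assume UV: "U \<in> topspace (stone_space ?A)" "V \<in> topspace (stone_space ?A)"
      and eq: "\<And>x. of_bool (gen x \<in> U) = (of_bool (gen x \<in> V) :: real)"
    have "g \<in> U \<longleftrightarrow> g \<in> V" if "g \<in> tree_sets \<union> range branch" for g
      using gen_surj[OF that] eq by (metis of_bool_eq_iff)
    thus "U = V"
      using ultrafilter_eqI[of U "tree_sets \<union> range branch" V] UV
      by (simp add: topspace_stone_space[OF sub] flip: branch_algebra_def)
  next
    fix U assume "U \<in> topspace (stone_space ?A)"
    hence U: "U \<in> ultrafilters ?A" by (simp add: topspace_stone_space[OF sub])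
    define c where "c \<longleftrightarrow> (\<exists>\<tau>. (\<forall>n. cone (stem \<tau> n) \<in> U) \<and> branch \<tau> \<in> U)"
    define tail where "tail = (\<lambda>(x :: nat \<Rightarrow> nat) n. x (Suc n))"
    define g :: "nat \<Rightarrow> (nat \<Rightarrow> nat) \<Rightarrow> real" where
      "g = (\<lambda>n x. if x 0 = 0 then
          of_bool (truncated_branch (tail x) n \<in> U \<or> cone (stem (tail x) n) \<in> U \<and> c) else of_bool (gen x \<in> U))"
    have "continuous_map baire_space euclideanreal (g n)" for n
    proof (rule continuous_map_baire_spaceI[where n = "Suc n"])
      fix x x' :: "nat \<Rightarrow> nat" assume eq: "\<And>i. i < Suc n \<Longrightarrow> x' i = x i"
      have "truncated_branch (tail x') n = truncated_branch (tail x) n"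
        by (rule truncated_branch_cong) (simp add: tail_def eq)
      moreover have "stem (tail x') n = stem (tail x) n" by (simp add: stem_eq_iff tail_def eq)
      ultimately show "g n x' = g n x" using eq[of 0] by (simp add: g_def gen_def)
    qed
    moreover have "(\<lambda>n. g n x) \<longlonglongrightarrow> of_bool (gen x \<in> U)" for x
    proof -
      have "\<exists>n0. \<forall>n\<ge>n0. g n x = of_bool (gen x \<in> U)"
      proof (cases "x 0 = 0")
        case True
        hence "gen x = branch (tail x)" by (simp add: gen_def tail_def)
        moreover obtain n0 where "\<forall>n\<ge>n0. (truncated_branch (tail x) n \<in> U \<or> cone (stem (tail x) n) \<in> U \<and> c)
            \<longleftrightarrow> branch (tail x) \<in> U"
          using branch_baire_one[OF U, of "tail x"] unfolding c_def by blast
        ultimately show ?thesis using True by (intro exI[of _ n0]) (simp add: g_def)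
      qed (simp add: g_def)
      thus ?thesis by (intro tendsto_eventually) (simp add: eventually_sequentially)
    qed
    ultimately show "\<exists>g. (\<forall>n. continuous_map baire_space euclideanreal (g n)) \<and>
        (\<forall>x. (\<lambda>n. g n x) \<longlonglongrightarrow> of_bool (gen x \<in> U))" by blast
  qed
qed

section \<open>Copies of the sequence space in a Banach space\<close>

context banach_space_on
begin

abbreviation diff :: "'e \<Rightarrow> 'e \<Rightarrow> 'e" where "diff x y \<equiv> add x (scl (- 1) y)"

lemma add_left_commute: "x \<in> E \<Longrightarrow> y \<in> E \<Longrightarrow> z \<in> E \<Longrightarrow> add x (add y z) = add y (add x z)"
  by (metis add_assoc add_commute)

lemma neg_neg: "x \<in> E \<Longrightarrow> scl (- 1) (scl (- 1) x) = x"
  by (simp add: scale_scale scale_one)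

lemma cancel: "x \<in> E \<Longrightarrow> y \<in> E \<Longrightarrow> add (scl (- 1) x) (add x y) = y"
  using add_assoc[of "scl (- 1) x" x y] add_minus[of x] add_commute[of "scl (- 1) x" x]
    add_commute[of zero y] add_zero[of y] by (simp add: scale_in zero_in)

lemma diff_in: "x \<in> E \<Longrightarrow> y \<in> E \<Longrightarrow> diff x y \<in> E"
  by (intro add_in scale_in)

lemma add_diff_diff: "x \<in> E \<Longrightarrow> y \<in> E \<Longrightarrow> z \<in> E \<Longrightarrow> add (diff x y) (diff y z) = diff x z"
  by (simp add: add_assoc scale_in add_in cancel)

lemma nrm_diff_triangle:
  "x \<in> E \<Longrightarrow> y \<in> E \<Longrightarrow> z \<in> E \<Longrightarrow> nrm (diff x z) \<le> nrm (diff x y) + nrm (diff y z)"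
  using nrm_triangle[of "diff x y" "diff y z"] by (simp add: diff_in add_diff_diff)

lemma nrm_diff_commute: "x \<in> E \<Longrightarrow> y \<in> E \<Longrightarrow> nrm (diff x y) = nrm (diff y x)"
  using nrm_scale[of "diff x y" "- 1"] add_commute[of "scl (- 1) x" y]
  by (simp add: diff_in scale_add_right scale_in neg_neg)

lemma diff_add_add:
  assumes "x \<in> E" "y \<in> E" "x' \<in> E" "y' \<in> E"
  shows "diff (add x y) (add x' y') = add (diff x x') (diff y y')"
  using assms by (simp add: scale_add_right add_assoc add_in scale_in add_left_commute[of y])

lemma diff_scale: "x \<in> E \<Longrightarrow> y \<in> E \<Longrightarrow> diff (scl c x) (scl c y) = scl c (diff x y)"
  by (simp add: scale_add_right scale_in scale_scale)

lemma diff_zero: "x \<in> E \<Longrightarrow> diff x zero = x"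
  by (metis add_commute add_minus add_zero cancel scale_in zero_in)

lemma nrm_zero: "nrm zero = 0"
  using nrm_eq_zero zero_in by blast

lemma abs_nrm_diff_le:
  assumes "x \<in> E" "y \<in> E"
  shows "\<bar>nrm x - nrm y\<bar> \<le> nrm (diff x y)"
  using nrm_diff_triangle[of x y zero] nrm_diff_triangle[of y x zero] nrm_diff_commute[of x y] assms
  by (simp add: diff_zero zero_in)

definition converges :: "(nat \<Rightarrow> 'e) \<Rightarrow> 'e \<Rightarrow> bool" where
  "converges s l \<longleftrightarrow> (\<lambda>n. nrm (diff (s n) l)) \<longlonglongrightarrow> 0"

lemma converges_unique:
  assumes s: "\<And>n. s n \<in> E" and l: "l \<in> E" "l' \<in> E" and "converges s l" "converges s l'"
  shows "l = l'"
proof -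
  have "(\<lambda>n. nrm (diff (s n) l) + nrm (diff (s n) l')) \<longlonglongrightarrow> 0 + 0"
    using assms(4,5) unfolding converges_def by (rule tendsto_add)
  moreover have "nrm (diff l l') \<le> nrm (diff (s n) l) + nrm (diff (s n) l')" for n
    using nrm_diff_triangle[of l "s n" l'] nrm_diff_commute[of l "s n"] s l by simp
  ultimately have "nrm (diff l l') \<le> 0"
    by (intro LIMSEQ_le_const[where X = "\<lambda>n. nrm (diff (s n) l) + nrm (diff (s n) l')"]) auto
  hence "diff l l' = zero" using nrm_eq_zero[OF diff_in[OF l]] nrm_ge_zero[OF diff_in[OF l]] by simp
  moreover have "add (diff l l') l' = l"
    using add_assoc[of l "scl (- 1) l'" l'] add_commute[of "scl (- 1) l'" l'] l
    by (simp add: scale_in add_minus add_zero)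
  ultimately show "l = l'" using l by (metis add_commute add_zero zero_in)
qed

lemma converges_add:
  assumes E: "\<And>n. s n \<in> E" "\<And>n. t n \<in> E" "l \<in> E" "k \<in> E" and c: "converges s l" "converges t k"
  shows "converges (\<lambda>n. add (s n) (t n)) (add l k)"
  unfolding converges_def
proof (rule tendsto_sandwich[OF _ _ tendsto_const])
  show "(\<lambda>n. nrm (diff (s n) l) + nrm (diff (t n) k)) \<longlonglongrightarrow> 0"
    using tendsto_add[OF c[unfolded converges_def]] by simp
  show "\<forall>\<^sub>F n in sequentially. 0 \<le> nrm (diff (add (s n) (t n)) (add l k))"
    using E by (simp add: nrm_ge_zero diff_in add_in)
  show "\<forall>\<^sub>F n in sequentially. nrm (diff (add (s n) (t n)) (add l k)) \<le> nrm (diff (s n) l) + nrm (diff (t n) k)"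
    using E by (simp add: diff_add_add nrm_triangle diff_in)
qed

lemma converges_scale:
  assumes E: "\<And>n. s n \<in> E" "l \<in> E" and c: "converges s l"
  shows "converges (\<lambda>n. scl c (s n)) (scl c l)"
  using tendsto_mult_left[OF c[unfolded converges_def], of "\<bar>c\<bar>"] E
  by (simp add: converges_def diff_scale nrm_scale diff_in)

lemma converges_nrm:
  assumes E: "\<And>n. s n \<in> E" "l \<in> E" and c: "converges s l"
  shows "(\<lambda>n. nrm (s n)) \<longlonglongrightarrow> nrm l"
proof (rule LIM_zero_cancel, rule tendsto_rabs_zero_cancel, rule tendsto_sandwich[OF _ _ tendsto_const])
  show "(\<lambda>n. nrm (diff (s n) l)) \<longlonglongrightarrow> 0" using c by (simp add: converges_def)
qed (use E abs_nrm_diff_le in auto)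

primrec partial_sum :: "(nat \<Rightarrow> 'e) \<Rightarrow> (nat \<Rightarrow> real) \<Rightarrow> nat \<Rightarrow> 'e" where
  "partial_sum y a 0 = zero"
| "partial_sum y a (Suc n) = add (partial_sum y a n) (scl (a n) (y n))"

lemma partial_sum_in: "(\<And>n. y n \<in> E) \<Longrightarrow> partial_sum y a n \<in> E"
  by (induction n) (simp_all add: zero_in add_in scale_in)

lemma partial_sum_add:
  assumes y: "\<And>n. y n \<in> E"
  shows "partial_sum y (\<lambda>n. a n + b n) n = add (partial_sum y a n) (partial_sum y b n)"
proof (induction n)
  case (Suc n)
  let ?p = "partial_sum y a n" and ?q = "partial_sum y b n"
  have E: "?p \<in> E" "?q \<in> E" "scl (a n) (y n) \<in> E" "scl (b n) (y n) \<in> E"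
    using partial_sum_in y scale_in by auto
  show ?case
    using E by (simp add: Suc y scale_add_left add_assoc add_in add_left_commute[of _ ?q])
qed (simp add: add_zero zero_in)

lemma scale_zero: "scl c zero = zero"
  using nrm_scale[OF zero_in, of c] nrm_eq_zero[OF scale_in[OF zero_in], of c] by (simp add: nrm_zero)

lemma partial_sum_scale:
  "(\<And>n. y n \<in> E) \<Longrightarrow> partial_sum y (\<lambda>n. c * a n) n = scl c (partial_sum y a n)"
  by (induction n) (simp_all add: scale_zero scale_add_right partial_sum_in scale_in scale_scale)

lemma nrm_partial_sum_diff:
  assumes y: "\<And>n. y n \<in> E" "\<And>n. nrm (y n) \<le> C" and "n \<le> m"
  shows "nrm (diff (partial_sum y a m) (partial_sum y a n)) \<le> C * (\<Sum>k=n..<m. \<bar>a k\<bar>)"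
  using \<open>n \<le> m\<close>
proof (induction m rule: dec_induct)
  case base
  show ?case by (simp add: add_minus partial_sum_in y nrm_zero)
next
  case (step m)
  let ?p = "partial_sum y a m" and ?q = "partial_sum y a n" and ?t = "scl (a m) (y m)"
  have E: "?p \<in> E" "?q \<in> E" "?t \<in> E" using partial_sum_in y(1) scale_in by auto
  have "diff (add ?p ?t) ?q = add (diff ?p ?q) ?t"
    using E by (simp add: add_assoc scale_in add_commute[of ?t])
  hence "nrm (diff (add ?p ?t) ?q) \<le> nrm (diff ?p ?q) + nrm ?t"
    using nrm_triangle[of "diff ?p ?q" ?t] E by (simp add: diff_in)
  also have "nrm ?t = \<bar>a m\<bar> * nrm (y m)" by (simp add: nrm_scale y)
  also have "\<bar>a m\<bar> * nrm (y m) \<le> \<bar>a m\<bar> * C" using y(2) by (intro mult_left_mono) auto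
  finally show ?case using step by (simp add: algebra_simps)
qed

lemma partial_sum_converges:
  assumes y: "\<And>n. y n \<in> E" "\<And>n. nrm (y n) \<le> C" and a: "a \<in> l1_space"
  obtains l where "l \<in> E" "converges (partial_sum y a) l"
proof -
  let ?p = "partial_sum y a"
  have C: "0 \<le> C" using order_trans[OF nrm_ge_zero[OF y(1)[of 0]] y(2)] .
  have near: "\<exists>N. \<forall>n\<ge>N. \<forall>m\<ge>n. nrm (diff (?p m) (?p n)) < e" if "e > 0" for e
  proof -
    have "e / (C + 1) > 0" using that C by simp
    with a obtain N where N: "\<forall>n\<ge>N. \<forall>m. \<bar>\<Sum>k=n..<m. \<bar>a k\<bar>\<bar> < e / (C + 1)"
      unfolding l1_space_def mem_Collect_eq summable_Cauchy real_norm_def by blast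
    have "nrm (diff (?p m) (?p n)) < e" if nm: "n \<ge> N" "m \<ge> n" for n m
    proof -
      have "(\<Sum>k=n..<m. \<bar>a k\<bar>) < e / (C + 1)" using N nm by (metis abs_ge_self le_less_trans)
      hence "(C + 1) * (\<Sum>k=n..<m. \<bar>a k\<bar>) < e" using C by (simp add: field_simps)
      moreover have "(\<Sum>k=n..<m. \<bar>a k\<bar>) \<ge> 0" by (simp add: sum_nonneg)
      ultimately show ?thesis
        using nrm_partial_sum_diff[where y = y, OF y nm(2), of a] by (simp only: distrib_right)
    qed
    thus ?thesis by blast
  qed
  have "\<exists>l\<in>E. (\<lambda>n. nrm (diff (?p n) l)) \<longlonglongrightarrow> 0"
  proof (rule complete)
    show "?p n \<in> E" for n by (rule partial_sum_in[where y = y, OF y(1)])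
    fix e :: real assume "e > 0"
    then obtain N where N: "\<forall>n\<ge>N. \<forall>m\<ge>n. nrm (diff (?p m) (?p n)) < e" using near by blast
    have "nrm (diff (?p m) (?p n)) < e" if "m \<ge> N" "n \<ge> N" for m n
      using N that nrm_diff_commute[of "?p m" "?p n"] partial_sum_in[where y = y, OF y(1)]
      by (metis linear)
    thus "\<exists>N. \<forall>m\<ge>N. \<forall>n\<ge>N. nrm (diff (?p m) (?p n)) < e" by blast
  qed
  thus thesis using that by (auto simp: converges_def)
qed

text \<open>
  For coefficients \<open>a\<close>, independence gives a functional that is large on the terms with \<open>a k \<ge> 0\<close> and small
  on the others, and one with the opposite behaviour. Their difference is at least \<open>d * (\<Sum>k<n. \<bar>a k\<bar>)\<close> at
  the partial sum; it is a difference, and not a single functional, that is free of the unknown level \<open>r\<close>.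
\<close>
lemma contains_l1I:
  fixes y :: "nat \<Rightarrow> 'e" and F :: "('e \<Rightarrow> real) set"
  assumes y: "\<And>n. y n \<in> E" "\<And>n. nrm (y n) \<le> C"
    and add: "\<And>\<phi> x z. \<phi> \<in> F \<Longrightarrow> x \<in> E \<Longrightarrow> z \<in> E \<Longrightarrow> \<phi> (add x z) = \<phi> x + \<phi> z"
    and scale: "\<And>\<phi> c x. \<phi> \<in> F \<Longrightarrow> x \<in> E \<Longrightarrow> \<phi> (scl c x) = c * \<phi> x"
    and M: "M > 0" "\<And>\<phi> x. \<phi> \<in> F \<Longrightarrow> x \<in> E \<Longrightarrow> \<bar>\<phi> x\<bar> \<le> M * nrm x"
    and d: "d > 0"
    and indep: "\<And>n P. \<exists>\<phi>\<in>F. \<forall>k<n. if P k then \<phi> (y k) \<le> r else r + d \<le> \<phi> (y k)"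
  shows "contains_l1 E add scl nrm"
proof -
  let ?p = "partial_sum y"
  note pE = partial_sum_in[where y = y, OF y(1)]
  have \<phi>sum: "\<phi> (?p a n) = (\<Sum>k<n. a k * \<phi> (y k))" if "\<phi> \<in> F" for \<phi> a n
  proof (induction n)
    case 0
    have "\<phi> (scl 0 zero) = 0 * \<phi> zero" by (rule scale[OF that zero_in])
    thus ?case by (simp add: scale_zero)
  qed (simp add: add[OF that pE scale_in[OF y(1)]] scale[OF that y(1)])
  have lower: "d / (2 * M) * (\<Sum>k<n. \<bar>a k\<bar>) \<le> nrm (?p a n)" for a n
  proof -
    obtain \<phi> where \<phi>: "\<phi> \<in> F" "\<forall>k<n. if a k < 0 then \<phi> (y k) \<le> r else r + d \<le> \<phi> (y k)"
      using indep[of n "\<lambda>k. a k < 0"] by blast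
    obtain \<psi> where \<psi>: "\<psi> \<in> F" "\<forall>k<n. if \<not> a k < 0 then \<psi> (y k) \<le> r else r + d \<le> \<psi> (y k)"
      using indep[of n "\<lambda>k. \<not> a k < 0"] by blast
    have "d * \<bar>a k\<bar> \<le> a k * (\<phi> (y k) - \<psi> (y k))" if "k < n" for k
    proof (cases "a k < 0")
      case True
      hence "d \<le> \<psi> (y k) - \<phi> (y k)"
        using \<phi>(2)[rule_format, OF that] \<psi>(2)[rule_format, OF that] by simp
      from mult_left_mono[OF this, of "- a k"] True show ?thesis by (simp add: algebra_simps)
    next
      case False
      hence "d \<le> \<phi> (y k) - \<psi> (y k)"
        using \<phi>(2)[rule_format, OF that] \<psi>(2)[rule_format, OF that] by simp
      from mult_left_mono[OF this, of "a k"] False show ?thesis by (simp add: algebra_simps)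
    qed
    hence "(\<Sum>k<n. d * \<bar>a k\<bar>) \<le> (\<Sum>k<n. a k * (\<phi> (y k) - \<psi> (y k)))"
      by (intro sum_mono) simp
    also have "\<dots> = \<phi> (?p a n) - \<psi> (?p a n)"
      by (simp add: \<phi>sum[OF \<phi>(1)] \<phi>sum[OF \<psi>(1)] sum_subtractf right_diff_distrib)
    also have "\<dots> \<le> 2 * M * nrm (?p a n)"
      using M(2)[OF \<phi>(1) pE[of a n]] M(2)[OF \<psi>(1) pE[of a n]] by linarith
    finally have "d * (\<Sum>k<n. \<bar>a k\<bar>) \<le> 2 * M * nrm (?p a n)" by (simp add: sum_distrib_left)
    thus ?thesis using M(1) by (simp add: field_simps)
  qed
  have upper: "nrm (?p a n) \<le> C * (\<Sum>k<n. \<bar>a k\<bar>)" for a n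
    using nrm_partial_sum_diff[where y = y, OF y, of 0 n a] by (simp add: diff_zero pE lessThan_atLeast0)
  define T where "T = (\<lambda>a. SOME l. l \<in> E \<and> converges (?p a) l)"
  have T: "T a \<in> E" "converges (?p a) (T a)" if a: "a \<in> l1_space" for a
  proof -
    have "\<exists>l. l \<in> E \<and> converges (?p a) l"
      using partial_sum_converges[where y = y, OF y a] by metis
    hence "T a \<in> E \<and> converges (?p a) (T a)" unfolding T_def by (rule someI_ex)
    thus "T a \<in> E" "converges (?p a) (T a)" by auto
  qed
  have l1_add: "(\<lambda>n. a n + b n) \<in> l1_space" if "a \<in> l1_space" "b \<in> l1_space" for a b
  proof -
    have "summable (\<lambda>n. \<bar>a n\<bar> + \<bar>b n\<bar>)" using that by (simp add: l1_space_def summable_add)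
    thus ?thesis unfolding l1_space_def mem_Collect_eq
      by (rule summable_comparison_test') (simp add: abs_triangle_ineq)
  qed
  have l1_scale: "(\<lambda>n. t * a n) \<in> l1_space" if "a \<in> l1_space" for a t
    using that by (simp add: l1_space_def abs_mult summable_mult)
  show ?thesis
    unfolding contains_l1_def
  proof (rule exI[of _ T], rule exI[of _ "d / (2 * M)"], rule exI[of _ C], intro conjI ballI allI)
    show "0 < d / (2 * M)" using d M(1) by simp
    show "T ` l1_space \<subseteq> E" using T(1) by blast
    fix a assume a: "a \<in> l1_space"
    show "T (\<lambda>n. t * a n) = scl t (T a)" for t
      using converges_scale[OF pE T(1)[OF a] T(2)[OF a], of t]
      by (intro converges_unique[OF pE T(1)[OF l1_scale[OF a]] scale_in[OF T(1)[OF a]] T(2)[OF l1_scale[OF a]]])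
        (simp add: partial_sum_scale[where y = y, OF y(1)] converges_def)
    show "T (\<lambda>n. a n + b n) = add (T a) (T b)" if b: "b \<in> l1_space" for b
      using converges_add[OF pE pE T(1)[OF a] T(1)[OF b] T(2)[OF a] T(2)[OF b]]
      by (intro converges_unique[OF pE T(1)[OF l1_add[OF a b]] add_in[OF T(1)[OF a] T(1)[OF b]] T(2)[OF l1_add[OF a b]]])
        (simp add: partial_sum_add[where y = y, OF y(1)] converges_def)
    have lim: "(\<lambda>n. nrm (?p a n)) \<longlonglongrightarrow> nrm (T a)" by (rule converges_nrm[OF pE T[OF a]])
    have s: "(\<lambda>n. \<Sum>k<n. \<bar>a k\<bar>) \<longlonglongrightarrow> (\<Sum>n. \<bar>a n\<bar>)"
      using a by (simp add: l1_space_def summable_LIMSEQ)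
    show "d / (2 * M) * (\<Sum>n. \<bar>a n\<bar>) \<le> nrm (T a)"
      by (rule LIMSEQ_le[OF tendsto_mult_left[OF s] lim]) (use lower in blast)
    show "nrm (T a) \<le> C * (\<Sum>n. \<bar>a n\<bar>)"
      by (rule LIMSEQ_le[OF lim tendsto_mult_left[OF s]]) (use upper in blast)
  qed
qed

end

section \<open>The Stone space is not weakly Radon-Nikodym\<close>

text \<open>
  If a colour is not stable, then it can be eliminated: some smaller \<open>W\<close> in the family and infinitely many indices
  are left at which it is never good, also on all subsets of \<open>W\<close>. Eliminating all of the finitely many
  colours contradicts the last assumption, so at some stage a colour is stable.
\<close>
lemma stable_colour:
  fixes good :: "'c \<Rightarrow> 'i \<Rightarrow> 'q set \<Rightarrow> bool"
  assumes "finite C" and "infinite I0" and "W0 \<in> \<W>"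
    and mono: "\<And>c i W W'. good c i W \<Longrightarrow> W \<subseteq> W' \<Longrightarrow> good c i W'"
    and "\<And>I W. I \<subseteq> I0 \<Longrightarrow> infinite I \<Longrightarrow> W \<in> \<W> \<Longrightarrow> W \<subseteq> W0 \<Longrightarrow> \<exists>i\<in>I. \<exists>c\<in>C. good c i W"
  shows "\<exists>c\<in>C. \<exists>I\<subseteq>I0. infinite I \<and> (\<exists>W\<in>\<W>. W \<subseteq> W0 \<and>
    (\<forall>W'\<in>\<W>. W' \<subseteq> W \<longrightarrow> finite {i \<in> I. \<not> good c i W'}))"
  using assms(1-3,5)
proof (induction C arbitrary: I0 W0 rule: finite_induct)
  case empty
  thus ?case by blast
next
  case (insert c C)
  show ?case
  proof (cases "\<forall>W'\<in>\<W>. W' \<subseteq> W0 \<longrightarrow> finite {i \<in> I0. \<not> good c i W'}")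
    case True
    thus ?thesis using insert.prems by blast
  next
    case False
    then obtain W' where W': "W' \<in> \<W>" "W' \<subseteq> W0" and inf: "infinite {i \<in> I0. \<not> good c i W'}" by blast
    have "\<exists>i\<in>I. \<exists>d\<in>C. good d i W"
      if "I \<subseteq> {i \<in> I0. \<not> good c i W'}" "infinite I" "W \<in> \<W>" "W \<subseteq> W'" for I W
    proof -
      have sub: "I \<subseteq> I0" "W \<subseteq> W0" using that(1,4) W'(2) by blast+
      from insert.prems(3)[OF sub(1) that(2,3) sub(2)]
      obtain i d where "i \<in> I" "d \<in> insert c C" "good d i W" by blast
      moreover have "d \<noteq> c" using mono[OF \<open>good d i W\<close> that(4)] that(1) \<open>i \<in> I\<close> by auto
      ultimately show ?thesis by blast
    qed
    hence "\<exists>d\<in>C. \<exists>I\<subseteq>{i \<in> I0. \<not> good c i W'}. infinite I \<and> (\<exists>W\<in>\<W>. W \<subseteq> W' \<and>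
        (\<forall>V\<in>\<W>. V \<subseteq> W \<longrightarrow> finite {i \<in> I. \<not> good d i V}))"
      by (rule insert.IH[OF inf W'(1)])
    thus ?thesis
    proof (elim bexE exE conjE)
      fix d I W
      assume "d \<in> C" and I: "I \<subseteq> {i \<in> I0. \<not> good c i W'}" and IW: "infinite I" "W \<in> \<W>" "W \<subseteq> W'"
        "\<forall>V\<in>\<W>. V \<subseteq> W \<longrightarrow> finite {i \<in> I. \<not> good d i V}"
      show ?thesis
        by (rule bexI[of _ d], rule exI[of _ I], intro conjI bexI[of _ W])
          (use \<open>d \<in> C\<close> I IW W'(2) in auto)
    qed
  qed
qed

text \<open>
  Since almost every index oscillates on each of the finitely many sets that realise the sign patterns
  found so far, some index oscillates on all of them; shrinking each set in two ways doubles the number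
  of patterns.
\<close>
lemma independent_sequence:
  fixes F :: "'i \<Rightarrow> 'q \<Rightarrow> real"
  assumes I: "infinite I" and W0: "W0 \<in> \<W>"
    and osc: "\<And>W. W \<in> \<W> \<Longrightarrow> W \<subseteq> W0 \<Longrightarrow>
      finite {i \<in> I. \<not> ((\<exists>q\<in>W. F i q < r) \<and> (\<exists>q\<in>W. s < F i q))}"
    and below: "\<And>W i q. W \<in> \<W> \<Longrightarrow> q \<in> W \<Longrightarrow> F i q < r \<Longrightarrow> \<exists>W'\<in>\<W>. W' \<subseteq> W \<and> (\<forall>q\<in>W'. F i q < r)"
    and above: "\<And>W i q. W \<in> \<W> \<Longrightarrow> q \<in> W \<Longrightarrow> s < F i q \<Longrightarrow> \<exists>W'\<in>\<W>. W' \<subseteq> W \<and> (\<forall>q\<in>W'. s < F i q)"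
  obtains \<iota> :: "nat \<Rightarrow> 'i" where
    "\<And>n P. \<exists>W\<in>\<W>. W \<subseteq> W0 \<and> (\<forall>k<n. \<forall>q\<in>W. if P k then F (\<iota> k) q < r else s < F (\<iota> k) q)"
proof -
  define Q where "Q l \<longleftrightarrow> (\<forall>P. \<exists>W\<in>\<W>. W \<subseteq> W0 \<and>
    (\<forall>k<length l. \<forall>q\<in>W. if P k then F (l ! k) q < r else s < F (l ! k) q))" for l
  have step: "\<exists>i. Q (l @ [i])" if l: "Q l" for l
  proof -
    let ?n = "length l"
    have "\<forall>S. \<exists>W. W \<in> \<W> \<and> W \<subseteq> W0 \<and>
        (\<forall>k<?n. \<forall>q\<in>W. if k \<in> S then F (l ! k) q < r else s < F (l ! k) q)"
    proof
      fix S :: "nat set"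
      show "\<exists>W. W \<in> \<W> \<and> W \<subseteq> W0 \<and>
          (\<forall>k<?n. \<forall>q\<in>W. if k \<in> S then F (l ! k) q < r else s < F (l ! k) q)"
        using l[unfolded Q_def, THEN spec, of "\<lambda>k. k \<in> S"] by blast
    qed
    then obtain w where w: "\<And>S. w S \<in> \<W>" "\<And>S. w S \<subseteq> W0"
        "\<And>S k q. k < ?n \<Longrightarrow> q \<in> w S \<Longrightarrow> if k \<in> S then F (l ! k) q < r else s < F (l ! k) q"
      by metis
    let ?bad = "\<lambda>S. {i \<in> I. \<not> ((\<exists>q\<in>w S. F i q < r) \<and> (\<exists>q\<in>w S. s < F i q))}"
    have "finite (\<Union>S\<in>Pow {..<?n}. ?bad S)"
      using osc[OF w(1,2)] by (intro finite_UN_I) auto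
    then obtain i where i: "i \<in> I" "i \<notin> (\<Union>S\<in>Pow {..<?n}. ?bad S)"
      using I by (meson finite_subset subsetI)
    have "Q (l @ [i])"
      unfolding Q_def
    proof
      fix P :: "nat \<Rightarrow> bool"
      define S where "S = {k. k < ?n \<and> P k}"
      have "S \<in> Pow {..<?n}" by (auto simp: S_def)
      with i have ex: "\<exists>q\<in>w S. F i q < r" "\<exists>q\<in>w S. s < F i q" by blast+
      have "\<exists>W\<in>\<W>. W \<subseteq> w S \<and> (\<forall>q\<in>W. if P ?n then F i q < r else s < F i q)"
        using ex below[OF w(1)] above[OF w(1)] by (cases "P ?n") (simp; metis)+
      then obtain W where W: "W \<in> \<W>" "W \<subseteq> w S" "\<forall>q\<in>W. if P ?n then F i q < r else s < F i q" by blast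
      have "if P k then F ((l @ [i]) ! k) q < r else s < F ((l @ [i]) ! k) q"
        if "k < length (l @ [i])" "q \<in> W" for k q
      proof (cases "k < ?n")
        case True
        with w(3)[OF True, of q S] W(2) that show ?thesis by (auto simp: nth_append S_def)
      next
        case False
        with that have "k = ?n" by simp
        with W(3) that show ?thesis by simp
      qed
      hence "\<forall>k<length (l @ [i]). \<forall>q\<in>W. if P k then F ((l @ [i]) ! k) q < r else s < F ((l @ [i]) ! k) q"
        by blast
      moreover have "W \<subseteq> W0" using W(2) w(2) by (rule subset_trans)
      ultimately show "\<exists>W\<in>\<W>. W \<subseteq> W0 \<and>
          (\<forall>k<length (l @ [i]). \<forall>q\<in>W. if P k then F ((l @ [i]) ! k) q < r else s < F ((l @ [i]) ! k) q)"
        by (intro bexI[OF _ W(1)] conjI)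
    qed
    thus ?thesis ..
  qed
  define g where "g = rec_nat [] (\<lambda>n l. l @ [SOME i. Q (l @ [i])])"
  define \<iota> where "\<iota> n = (SOME i. Q (g n @ [i]))" for n
  have g0: "g 0 = []" and gS: "g (Suc n) = g n @ [\<iota> n]" for n by (simp_all add: g_def \<iota>_def)
  have Qg: "Q (g n)" for n
  proof (induction n)
    case 0
    show ?case using W0 by (auto simp: Q_def g0)
  next
    case (Suc n)
    show ?case unfolding gS \<iota>_def by (rule someI_ex) (rule step[OF Suc])
  qed
  have g: "g n = map \<iota> [0..<n]" for n by (induction n) (simp_all add: g0 gS)
  have len: "length (g n) = n" for n by (simp add: g)
  show thesis
  proof (rule that)
    fix n and P :: "nat \<Rightarrow> bool"
    obtain W where W: "W \<in> \<W>" "W \<subseteq> W0"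
        "\<forall>k<n. \<forall>q\<in>W. if P k then F (g n ! k) q < r else s < F (g n ! k) q"
      using Qg[of n, unfolded Q_def, THEN spec, of P] unfolding len by blast
    have "\<forall>k<n. \<forall>q\<in>W. if P k then F (\<iota> k) q < r else s < F (\<iota> k) q"
    proof (intro allI impI ballI)
      fix k q assume k: "k < n" and q: "q \<in> W"
      have "g n ! k = \<iota> k" using k by (simp add: g)
      moreover have "if P k then F (g n ! k) q < r else s < F (g n ! k) q" using W(3) k q by blast
      ultimately show "if P k then F (\<iota> k) q < r else s < F (\<iota> k) q" by (simp only:)
    qed
    with W(1,2) show "\<exists>W\<in>\<W>. W \<subseteq> W0 \<and> (\<forall>k<n. \<forall>q\<in>W. if P k then F (\<iota> k) q < r else s < F (\<iota> k) q)"
      by blast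
  qed
qed

text \<open>
  A form of the Baire category theorem. Otherwise for all \<open>m\<close> and \<open>u\<close> some child of \<open>u\<close> has no branch
  in \<open>L m\<close> through it; following at level \<open>m\<close> the child that avoids \<open>L m\<close> leads to a branch that is
  in no \<open>L m\<close>.
\<close>
lemma covering_diagonal:
  fixes L :: "nat \<Rightarrow> (nat \<Rightarrow> nat) \<Rightarrow> bool"
  assumes "\<And>\<sigma>. \<exists>m. L m \<sigma>"
  obtains m u where "\<And>i. \<exists>\<sigma>. L m \<sigma> \<and> stem \<sigma> (length u) = u \<and> \<sigma> (length u) = i"
proof (rule ccontr)
  assume "\<not> thesis"
  hence "\<forall>m u. \<exists>i. \<forall>\<sigma>. stem \<sigma> (length u) = u \<longrightarrow> \<sigma> (length u) = i \<longrightarrow> \<not> L m \<sigma>" using that by blast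
  then obtain f where f: "\<And>m u \<sigma>. stem \<sigma> (length u) = u \<Longrightarrow> \<sigma> (length u) = f m u \<Longrightarrow> \<not> L m \<sigma>" by metis
  define g where "g = rec_nat [] (\<lambda>n u. u @ [f n u])"
  define \<sigma> where "\<sigma> n = f n (g n)" for n
  have "stem \<sigma> n = g n" for n by (induction n) (simp_all add: stem_Suc g_def \<sigma>_def, simp add: stem_def)
  hence "\<not> L m \<sigma>" for m using f[of \<sigma> "g m" m] by (metis \<sigma>_def length_stem)
  with assms show False by blast
qed

text \<open>
  A compact space that is mapped injectively and weak* continuously into the dual of a Banach space:
  \<open>h x p\<close> is the value at \<open>x\<close> of the functional that represents \<open>p\<close>.
\<close>
locale represented_compact = banach_space_on E add zero scl nrm
  for E :: "'e set" and add zero scl nrm +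
  fixes K :: "'k topology" and h :: "'e \<Rightarrow> 'k \<Rightarrow> real"
  assumes compact: "compact_space K"
    and cont: "x \<in> E \<Longrightarrow> continuous_map K euclideanreal (h x)"
    and h_add: "p \<in> topspace K \<Longrightarrow> x \<in> E \<Longrightarrow> y \<in> E \<Longrightarrow> h (add x y) p = h x p + h y p"
    and h_scale: "p \<in> topspace K \<Longrightarrow> x \<in> E \<Longrightarrow> h (scl c x) p = c * h x p"
    and h_bounded: "p \<in> topspace K \<Longrightarrow> \<exists>M. \<forall>x\<in>E. \<bar>h x p\<bar> \<le> M * nrm x"
    and h_separates: "p \<in> topspace K \<Longrightarrow> q \<in> topspace K \<Longrightarrow> p \<noteq> q \<Longrightarrow> \<exists>x\<in>E. h x p \<noteq> h x q"
begin

text \<open>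
  Every pair of distinct points is separated with difference 2 by a multiple of some vector, and the
  product of two disjoint closed sets is compact.
\<close>
lemma finite_separation:
  assumes C: "closedin K C" and D: "closedin K D" and CD: "C \<inter> D = {}"
  obtains X where "finite X" "X \<subseteq> E" "\<And>p q. p \<in> C \<Longrightarrow> q \<in> D \<Longrightarrow> \<exists>x\<in>X. 1 < \<bar>h x p - h x q\<bar>"
proof -
  let ?KK = "prod_topology K K"
  define V where "V x = {z \<in> topspace ?KK. \<bar>h x (fst z) - h x (snd z)\<bar> \<in> {1<..}}" for x
  have op: "openin ?KK (V x)" if "x \<in> E" for x
    unfolding V_def
  proof (rule openin_continuous_map_preimage)
    have "continuous_map ?KK euclideanreal (h x \<circ> fst)" "continuous_map ?KK euclideanreal (h x \<circ> snd)"
      using cont[OF that] by (auto intro: continuous_map_compose continuous_map_fst continuous_map_snd)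
    thus "continuous_map ?KK euclideanreal (\<lambda>z. \<bar>h x (fst z) - h x (snd z)\<bar>)"
      by (intro continuous_map_real_abs continuous_map_diff) (simp_all add: o_def)
  qed simp
  have cancel_2: "2 / d * d = 2" if "d \<noteq> 0" for d :: real using that by simp
  have "compactin K C" "compactin K D" using C D compact closedin_compact_space by auto
  hence "compactin ?KK (C \<times> D)" by (simp add: compactin_Times)
  moreover have "C \<times> D \<subseteq> \<Union> (V ` E)"
  proof
    fix z assume z: "z \<in> C \<times> D"
    then obtain p q where pq: "z = (p, q)" "p \<in> C" "q \<in> D" by blast
    hence top: "p \<in> topspace K" "q \<in> topspace K" using C D closedin_subset by blast+
    obtain x where x: "x \<in> E" "h x p \<noteq> h x q" using h_separates[OF top] pq CD by blast
    let ?c = "2 / (h x p - h x q)"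
    have "h (scl ?c x) p - h (scl ?c x) q = ?c * (h x p - h x q)"
      using x(1) by (simp only: h_scale top right_diff_distrib)
    also have "\<dots> = 2" by (rule cancel_2) (use x(2) in simp)
    finally have "z \<in> V (scl ?c x)" using top by (simp add: V_def pq)
    thus "z \<in> \<Union> (V ` E)" using scale_in[OF x(1)] by blast
  qed
  ultimately obtain \<F> where "finite \<F>" "\<F> \<subseteq> V ` E" "C \<times> D \<subseteq> \<Union> \<F>"
    using op unfolding compactin_def by (metis (no_types, lifting) imageE)
  then obtain X where X: "finite X" "X \<subseteq> E" "C \<times> D \<subseteq> \<Union> (V ` X)"
    by (metis finite_subset_image)
  show thesis
  proof (rule that[OF X(1,2)])
    fix p q assume "p \<in> C" "q \<in> D"
    with X(3) obtain x where "x \<in> X" "(p, q) \<in> V x" by blast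
    thus "\<exists>x\<in>X. 1 < \<bar>h x p - h x q\<bar>" by (auto simp: V_def)
  qed
qed

lemma h_zero: "p \<in> topspace K \<Longrightarrow> h zero p = 0"
  using h_scale[of p zero 0] zero_in by (simp add: scale_zero)

lemma h_range_bounded:
  assumes "x \<in> E"
  shows "\<exists>B. \<forall>p\<in>topspace K. \<bar>h x p\<bar> \<le> B"
proof -
  have "compactin euclideanreal (h x ` topspace K)"
    using image_compactin[OF _ cont[OF assms]] compact by (simp add: compact_space_def)
  hence "bounded (h x ` topspace K)" by (simp add: compact_imp_bounded)
  thus ?thesis by (auto simp: bounded_iff)
qed

text \<open>
  Only the first \<open>m\<close> terms of \<open>x\<close> separate \<open>C\<close> from its complement. The bounds by the same number \<open>m\<close> make
  countably many conditions suffice to cover all clopen sets.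
\<close>
definition separated_by :: "nat \<Rightarrow> 'k set \<Rightarrow> (nat \<Rightarrow> 'e) \<Rightarrow> bool" where
  "separated_by m C x \<longleftrightarrow> (\<forall>j. x j \<in> E \<and> nrm (x j) \<le> real m \<and> (\<forall>p\<in>topspace K. \<bar>h (x j) p\<bar> \<le> real m)) \<and>
     (\<forall>p\<in>C. \<forall>q\<in>topspace K - C. \<exists>j<m. 1 < \<bar>h (x j) p - h (x j) q\<bar>)"

lemma ex_separated_by:
  assumes C: "closedin K C" "openin K C"
  shows "\<exists>m x. separated_by m C x"
proof -
  have "closedin K (topspace K - C)" using C(2) by blast
  then obtain X where X: "finite X" "X \<subseteq> E"
      and sep: "\<And>p q. p \<in> C \<Longrightarrow> q \<in> topspace K - C \<Longrightarrow> \<exists>x\<in>X. 1 < \<bar>h x p - h x q\<bar>"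
    using finite_separation[OF C(1)] by blast
  obtain xs where xs: "set xs = X" using finite_list[OF X(1)] by blast
  obtain B where B: "\<And>x p. x \<in> E \<Longrightarrow> p \<in> topspace K \<Longrightarrow> \<bar>h x p\<bar> \<le> B x" using h_range_bounded by metis
  \<comment> \<open>one number that bounds the norms and the values of all vectors at once\<close>
  define R where "R = (\<Sum>x\<in>X. \<bar>B x\<bar> + nrm x)"
  have R: "\<bar>B x\<bar> + nrm x \<le> R" if "x \<in> X" for x
    unfolding R_def using X that nrm_ge_zero by (intro member_le_sum) auto
  obtain m0 where m0: "R \<le> real m0" using real_arch_simple by blast
  define m where "m = max m0 (length xs)"
  define x where "x j = (if j < length xs then xs ! j else zero)" for j
  have "x j \<in> E \<and> nrm (x j) \<le> real m \<and> (\<forall>p\<in>topspace K. \<bar>h (x j) p\<bar> \<le> real m)" for j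
  proof (cases "j < length xs")
    case True
    hence "xs ! j \<in> X" using xs by auto
    moreover from this have "xs ! j \<in> E" using X by blast
    moreover have "R \<le> real m" using m0 by (simp add: m_def)
    ultimately show ?thesis
      using R[of "xs ! j"] B[of "xs ! j"] nrm_ge_zero[of "xs ! j"] True
      by (fastforce simp: x_def)
  qed (simp add: x_def zero_in nrm_zero h_zero)
  moreover have "\<exists>j<m. 1 < \<bar>h (x j) p - h (x j) q\<bar>" if pq: "p \<in> C" "q \<in> topspace K - C" for p q
  proof -
    obtain y where y: "y \<in> X" "1 < \<bar>h y p - h y q\<bar>" using sep[OF pq] by blast
    then obtain j where "j < length xs" "xs ! j = y" using xs by (metis in_set_conv_nth)
    thus ?thesis using y by (intro exI[of _ j]) (simp add: x_def m_def)
  qed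
  ultimately show ?thesis unfolding separated_by_def by blast
qed

end

lemma wrn_witness_represented:
  assumes K: "compact_space K" and w: "wrn_witness K E add zero scl nrm"
  obtains h where "represented_compact E add zero scl nrm K h"
proof -
  let ?W = "weak_star_topology E add scl nrm"
  from w obtain S where ban: "banach_space_on E add zero scl nrm"
    and hom: "K homeomorphic_space subtopology ?W S"
    unfolding wrn_witness_def by blast
  obtain f where f: "homeomorphic_map K (subtopology ?W S) f"
    using hom unfolding homeomorphic_space by blast
  have fD: "f p \<in> dual_on E add scl nrm" if "p \<in> topspace K" for p
    using homeomorphic_imp_surjective_map[OF f] that unfolding weak_star_topology_def by auto
  show thesis
  proof (rule that[of "\<lambda>x p. f p x"], intro represented_compact.intro represented_compact_axioms.intro)
    show "banach_space_on E add zero scl nrm" "compact_space K" by fact+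
    show "continuous_map K euclideanreal (\<lambda>p. f p x)" if "x \<in> E" for x
      using homeomorphic_imp_continuous_map[OF f] that
      unfolding weak_star_topology_def continuous_map_in_subtopology continuous_map_componentwise by blast
    fix p assume p: "p \<in> topspace K"
    note d = fD[OF p, unfolded dual_on_def mem_Collect_eq]
    show "f p (add x y) = f p x + f p y" if "x \<in> E" "y \<in> E" for x y using d that by blast
    show "f p (scl c x) = c * f p x" if "x \<in> E" for x c using d that by blast
    show "\<exists>M. \<forall>x\<in>E. \<bar>f p x\<bar> \<le> M * nrm x" using d by blast
    fix q assume q: "q \<in> topspace K" and ne: "p \<noteq> q"
    have "f p \<noteq> f q" using homeomorphic_imp_injective_map[OF f] p q ne by (auto dest: inj_onD)
    moreover have "f q \<in> extensional E" using fD[OF q] by (simp add: dual_on_def)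
    ultimately show "\<exists>x\<in>E. f p x \<noteq> f q x" using d by (metis extensionalityI)
  qed
qed

definition cylinder :: "nat \<Rightarrow> nat \<Rightarrow> nat set" where
  "cylinder k q = {q'. take_bit k q' = take_bit k q}"

definition cylinders :: "nat set set" where "cylinders = {cylinder k q |k q. True}"

lemma cylinder_self: "q \<in> cylinder k q" by (simp add: cylinder_def)

lemma cylinder_mono: "k \<le> l \<Longrightarrow> q' \<in> cylinder k q \<Longrightarrow> cylinder l q' \<subseteq> cylinder k q"
proof
  fix p assume kl: "k \<le> l" and q': "q' \<in> cylinder k q" and p: "p \<in> cylinder l q'"
  have "take_bit k p = take_bit k (take_bit l p)" using kl by (simp add: min_def)
  also have "\<dots> = take_bit k (take_bit l q')" using p by (simp add: cylinder_def)
  also have "\<dots> = take_bit k q" using kl q' by (simp add: cylinder_def min_def)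
  finally show "p \<in> cylinder k q" by (simp add: cylinder_def)
qed

lemma cylinder_bit:
  assumes "k \<le> i"
  shows "\<exists>q'\<in>cylinder k q. bit q' i" "\<exists>q'\<in>cylinder k q. \<not> bit q' i"
  using assms
  by (intro bexI[of _ "set_bit i q"] bexI[of _ "unset_bit i q"];
      simp add: cylinder_def take_bit_set_bit_eq take_bit_unset_bit_eq bit_set_bit_iff bit_unset_bit_iff)+

abbreviation branch_space :: "nat set set topology" where
  "branch_space \<equiv> stone_space branch_algebra"

abbreviation principal_point :: "nat list \<Rightarrow> nat \<Rightarrow> nat set set" where
  "principal_point u q \<equiv> principal branch_algebra (point u q)"

lemma principal_point_in: "principal_point u q \<in> topspace branch_space"
  by (simp add: topspace_stone_space branch_algebra_subalgebra principal_ultrafilter)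

abbreviation clopen_box :: "nat list \<Rightarrow> nat \<Rightarrow> nat \<Rightarrow> nat set set set" where
  "clopen_box u k q \<equiv> basic_open branch_algebra (box u k (take_bit k q))"

lemma principal_point_in_clopen_box: "principal_point u q' \<in> clopen_box u k q \<longleftrightarrow> q' \<in> cylinder k q"
proof -
  have "point u q' \<in> box u k (take_bit k q) \<longleftrightarrow> q' \<in> cylinder k q" by (simp add: box_def cylinder_def)
  thus ?thesis
    using principal_ultrafilter[OF branch_algebra_subalgebra, of "point u q'"]
    by (simp add: basic_open_def principal_def in_branch_algebra)
qed

lemma clopen_box_mono:
  assumes "k \<le> l" "q' \<in> cylinder k q"
  shows "clopen_box u l q' \<subseteq> clopen_box u k q"
proof -
  have "box u l (take_bit l q') \<subseteq> box u k (take_bit k q)"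
    using cylinder_mono[OF assms] by (auto simp: box_def cylinder_def)
  thus ?thesis
    using ultrafilterD(4)[OF branch_algebra_subalgebra _ _ in_branch_algebra(2)] by (auto simp: basic_open_def)
qed

lemma principal_point_neighbourhood:
  assumes W: "openin branch_space W" and m: "principal_point u q \<in> W"
  obtains l where "l \<ge> k" "clopen_box u l q \<subseteq> W"
proof -
  obtain l where l: "clopen_box u l q \<subseteq> W" using box_neighbourhood[OF W m] .
  have "clopen_box u (max k l) q \<subseteq> clopen_box u l q" by (rule clopen_box_mono) (simp_all add: cylinder_self)
  with l show thesis by (intro that[of "max k l"]) auto
qed

locale represented_branch_space = represented_compact E add zero scl nrm branch_space h
  for E :: "'e set" and add zero scl nrm h
begin

text \<open>
  Every single functional is bounded, and by a category argument those of the principal ultrafilters over \<open>u\<close>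
  have a common bound on some cylinder: otherwise there is a decreasing sequence of clopen boxes
  such that on the \<open>n\<close>-th one the functionals have norm more than \<open>n\<close>, which by compactness have a common point.
\<close>
lemma local_norm_bound:
  obtains M W where "M > 0" "W \<in> cylinders" "\<And>q x. q \<in> W \<Longrightarrow> x \<in> E \<Longrightarrow> \<bar>h x (principal_point u q)\<bar> \<le> M * nrm x"
proof (rule ccontr)
  note found = that
  assume no: "\<not> thesis"
  have step: "\<exists>l q'. k \<le> l \<and> q' \<in> cylinder k q \<and> (\<exists>x\<in>E. \<forall>p\<in>clopen_box u l q'. real (Suc n) * nrm x < \<bar>h x p\<bar>)"
    for k q n
  proof -
    obtain q' x where q': "q' \<in> cylinder k q" "x \<in> E" "real (Suc n) * nrm x < \<bar>h x (principal_point u q')\<bar>"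
      using found[of "real (Suc n)" "cylinder k q"] no unfolding cylinders_def by (force simp: not_le)
    let ?W = "{p \<in> topspace branch_space. \<bar>h x p\<bar> \<in> {real (Suc n) * nrm x<..}}"
    have "openin branch_space ?W"
      by (rule openin_continuous_map_preimage[OF continuous_map_real_abs[OF cont[OF q'(2)]]]) simp
    moreover have "principal_point u q' \<in> ?W" using q' principal_point_in by simp
    ultimately obtain l where "l \<ge> k" "clopen_box u l q' \<subseteq> ?W" by (rule principal_point_neighbourhood)
    thus ?thesis using q' by (intro exI[of _ l] exI[of _ q']) auto
  qed
  let ?next = "\<lambda>n s t. fst s \<le> fst t \<and> snd t \<in> cylinder (fst s) (snd s) \<and>
    (\<exists>x\<in>E. \<forall>p\<in>clopen_box u (fst t) (snd t). real (Suc n) * nrm x < \<bar>h x p\<bar>)"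
  have "\<exists>f. \<forall>n. True \<and> ?next n (f n) (f (Suc n))"
    by (rule dependent_nat_choice) (use step in auto)
  then obtain f where f: "\<And>n. ?next n (f n) (f (Suc n))" by blast
  define D where "D n = clopen_box u (fst (f n)) (snd (f n))" for n
  have "\<Inter> (range D) \<noteq> {}"
  proof (rule compact_space_imp_nest[OF compact])
    show "closedin branch_space (D n)" for n
      unfolding D_def by (rule closedin_basic_open[OF branch_algebra_subalgebra in_branch_algebra(2)])
    show "D n \<noteq> {}" for n
      unfolding D_def using principal_point_in_clopen_box cylinder_self by blast
    show "decseq D"
      unfolding decseq_Suc_iff D_def using f by (intro allI clopen_box_mono) auto
  qed
  then obtain p where p: "\<And>n. p \<in> D n" by blast
  hence "p \<in> topspace branch_space"
    by (auto simp: D_def basic_open_def topspace_stone_space branch_algebra_subalgebra)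
  then obtain M where M: "\<And>x. x \<in> E \<Longrightarrow> \<bar>h x p\<bar> \<le> M * nrm x" using h_bounded by blast
  obtain n where n: "M \<le> real n" using real_arch_simple by blast
  obtain x where x: "x \<in> E" "real (Suc n) * nrm x < \<bar>h x p\<bar>"
    using f[of n] p[of "Suc n"] unfolding D_def by blast
  have "M * nrm x \<le> real (Suc n) * nrm x" using n nrm_ge_zero[OF x(1)] by (intro mult_right_mono) auto
  with M[OF x(1)] x(2) show False by linarith
qed

text \<open>
  Every branch satisfies one of countably many conditions, so there are a bound \<open>m\<close> and a node \<open>u\<close> such
  that every child \<open>i\<close> of \<open>u\<close> lies on a branch that is separated from its complement by \<open>m\<close> vectors with
  bound \<open>m\<close>. Over \<open>u\<close> this branch is the set of labels with \<open>i\<close>-th digit 1. A cylinder constrains finitely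
  many digits only, so for all large \<open>i\<close> one of the \<open>m\<close> functions varies on it by more than 1. The
  colour of this variation is the number \<open>j\<close> of the function together with a level \<open>t\<close>, and a stable colour
  leads to an independent sequence.
\<close>
theorem l1_embeds: "contains_l1 E add scl nrm"
proof -
  define L where "L m \<sigma> \<longleftrightarrow> (\<exists>x. separated_by m (basic_open branch_algebra (branch \<sigma>)) x)" for m \<sigma>
  have "\<exists>m. L m \<sigma>" for \<sigma>
    unfolding L_def
    by (intro ex_separated_by closedin_basic_open openin_basic_open branch_algebra_subalgebra in_branch_algebra)
  then obtain m u where "\<And>i. \<exists>\<sigma>. L m \<sigma> \<and> stem \<sigma> (length u) = u \<and> \<sigma> (length u) = i"
    using covering_diagonal[of L] by blast
  then obtain \<sigma> x where \<sigma>: "\<And>i. stem (\<sigma> i) (length u) = u" "\<And>i. \<sigma> i (length u) = i"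
    and x: "\<And>i. separated_by m (basic_open branch_algebra (branch (\<sigma> i))) (x i)"
    unfolding L_def by metis
  let ?p = "principal_point u"
  have xE: "x i j \<in> E" "nrm (x i j) \<le> real m" "q \<in> topspace branch_space \<Longrightarrow> \<bar>h (x i j) q\<bar> \<le> real m" for i j q
    using x[of i] by (auto simp: separated_by_def)
  have branch_bit: "?p q \<in> basic_open branch_algebra (branch (\<sigma> i)) \<longleftrightarrow> bit q i" for q i
  proof -
    have "point u q \<in> branch (\<sigma> i) \<longleftrightarrow> bit q i" by (simp add: branch_def \<sigma>)
    thus ?thesis
      using principal_ultrafilter[OF branch_algebra_subalgebra, of "point u q"]
      by (simp add: basic_open_def principal_def in_branch_algebra)
  qed
  obtain M W0 where M: "M > 0" and W0: "W0 \<in> cylinders"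
    and bound: "\<And>q x. q \<in> W0 \<Longrightarrow> x \<in> E \<Longrightarrow> \<bar>h x (?p q)\<bar> \<le> M * nrm x"
    using local_norm_bound[of u] by blast
  \<comment> \<open>levels are multiples of 1/4, so that two consecutive levels lie within any interval of length 1\<close>
  define good where "good = (\<lambda>(j, t :: int) i W.
    (\<exists>q\<in>W. h (x i j) (?p q) < t / 4) \<and> (\<exists>q\<in>W. (t + 1) / 4 < h (x i j) (?p q)))"
  define C where "C = {..<m} \<times> {- 4 * int m..4 * int m + 1}"
  have oscillates: "\<exists>i\<in>I. \<exists>c\<in>C. good c i W" if I: "infinite I" and W: "W \<in> cylinders" for I W
  proof -
    obtain k q where kq: "W = cylinder k q" using W unfolding cylinders_def by blast
    obtain i where i: "i \<in> I" "k \<le> i" using I by (meson infinite_nat_iff_unbounded_le)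
    obtain q1 q2 where q12: "q1 \<in> W" "bit q1 i" "q2 \<in> W" "\<not> bit q2 i"
      using cylinder_bit[OF i(2)] kq by blast
    hence "?p q1 \<in> basic_open branch_algebra (branch (\<sigma> i))"
      "?p q2 \<in> topspace branch_space - basic_open branch_algebra (branch (\<sigma> i))"
      using branch_bit principal_point_in by auto
    then obtain j where j: "j < m" "1 < \<bar>h (x i j) (?p q1) - h (x i j) (?p q2)\<bar>"
      using x[of i] unfolding separated_by_def by blast
    obtain a b where ab: "a \<in> W" "b \<in> W" "h (x i j) (?p a) + 1 < h (x i j) (?p b)"
    proof (cases "h (x i j) (?p q1) < h (x i j) (?p q2)")
      case True thus thesis using that[of q1 q2] q12 j(2) by simp
    next
      case False thus thesis using that[of q2 q1] q12 j(2) by simp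
    qed
    define t where "t = \<lfloor>4 * h (x i j) (?p a)\<rfloor> + 1"
    have t: "4 * h (x i j) (?p a) < t" "t \<le> 4 * h (x i j) (?p a) + 1"
      unfolding t_def by linarith+
    have "\<bar>h (x i j) (?p a)\<bar> \<le> real m" by (rule xE(3)[OF principal_point_in])
    hence "- 4 * real m \<le> t" "t \<le> 4 * real m + 1" using t by linarith+
    hence "t \<in> {- 4 * int m..4 * int m + 1}" by (simp; linarith)
    moreover have "h (x i j) (?p a) < t / 4" "(t + 1) / 4 < h (x i j) (?p b)"
      using t ab(3) by simp_all
    ultimately show ?thesis
      using i(1) j(1) ab(1,2) by (intro bexI[of _ i] bexI[of _ "(j, t)"]) (auto simp: good_def C_def)
  qed
  have "\<exists>c\<in>C. \<exists>I\<subseteq>UNIV. infinite I \<and> (\<exists>W\<in>cylinders. W \<subseteq> W0 \<and>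
      (\<forall>W'\<in>cylinders. W' \<subseteq> W \<longrightarrow> finite {i \<in> I. \<not> good c i W'}))"
    by (rule stable_colour) (use W0 oscillates in \<open>auto simp: C_def good_def\<close>)
  then obtain j t I W where I: "infinite I" and W: "W \<in> cylinders" "W \<subseteq> W0"
    and stable: "\<And>W'. W' \<in> cylinders \<Longrightarrow> W' \<subseteq> W \<Longrightarrow> finite {i \<in> I. \<not> good (j, t) i W'}"
    by (metis surj_pair)
  define F where "F i q = h (x i j) (?p q)" for i q
  have local: "\<exists>W'\<in>cylinders. W' \<subseteq> V \<and> (\<forall>q\<in>W'. F i q \<in> S)"
    if V: "V \<in> cylinders" "q \<in> V" and S: "open S" "F i q \<in> S" for V q i S
  proof -
    obtain k q0 where kq: "V = cylinder k q0" using V unfolding cylinders_def by blast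
    let ?O = "{p \<in> topspace branch_space. h (x i j) p \<in> S}"
    have "openin branch_space ?O"
      by (rule openin_continuous_map_preimage[OF cont[OF xE(1)]]) (use S in simp)
    moreover have "?p q \<in> ?O" using S principal_point_in by (simp add: F_def)
    ultimately obtain l where l: "l \<ge> k" "clopen_box u l q \<subseteq> ?O" by (rule principal_point_neighbourhood)
    have "cylinder l q \<subseteq> V" using cylinder_mono[OF l(1)] V(2) kq by blast
    moreover have "F i q' \<in> S" if "q' \<in> cylinder l q" for q'
      using l(2) that principal_point_in_clopen_box[of u q' l q] by (auto simp: F_def)
    ultimately show ?thesis by (intro bexI[of _ "cylinder l q"]) (auto simp: cylinders_def)
  qed
  obtain \<iota> :: "nat \<Rightarrow> nat" where \<iota>: "\<And>n P. \<exists>V\<in>cylinders. V \<subseteq> W \<and>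
      (\<forall>k<n. \<forall>q\<in>V. if P k then F (\<iota> k) q < t / 4 else (t + 1) / 4 < F (\<iota> k) q)"
  proof (rule independent_sequence[OF I W(1), of F "t / 4" "(t + 1) / 4"])
    show "finite {i \<in> I. \<not> ((\<exists>q\<in>V. F i q < t / 4) \<and> (\<exists>q\<in>V. (t + 1) / 4 < F i q))}"
      if "V \<in> cylinders" "V \<subseteq> W" for V
      using stable[OF that] by (simp add: good_def F_def)
    show "\<exists>W'\<in>cylinders. W' \<subseteq> V \<and> (\<forall>q\<in>W'. F i q < t / 4)"
      if "V \<in> cylinders" "q \<in> V" "F i q < t / 4" for V i q
      using local[OF that(1,2), of "{..<t / 4}" i] that(3) by simp
    show "\<exists>W'\<in>cylinders. W' \<subseteq> V \<and> (\<forall>q\<in>W'. (t + 1) / 4 < F i q)"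
      if "V \<in> cylinders" "q \<in> V" "(t + 1) / 4 < F i q" for V i q
      using local[OF that(1,2), of "{(t + 1) / 4<..}" i] that(3) by simp
  next
    fix \<kappa> :: "nat \<Rightarrow> nat" assume \<kappa>: "\<And>n P. \<exists>V\<in>cylinders. V \<subseteq> W \<and>
      (\<forall>k<n. \<forall>q\<in>V. if P k then F (\<kappa> k) q < t / 4 else (t + 1) / 4 < F (\<kappa> k) q)"
    show thesis by (rule that[of \<kappa>]) (rule \<kappa>)
  qed
  show ?thesis
  proof (rule contains_l1I[where y = "\<lambda>n. x (\<iota> n) j" and F = "(\<lambda>q x. h x (?p q)) ` W0" and d = "1 / 4" and r = "t / 4"])
    show "x (\<iota> n) j \<in> E" "nrm (x (\<iota> n) j) \<le> real m" for n by (rule xE)+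
    show "\<exists>\<phi>\<in>(\<lambda>q x. h x (?p q)) ` W0. \<forall>k<n.
        if P k then \<phi> (x (\<iota> k) j) \<le> t / 4 else t / 4 + 1 / 4 \<le> \<phi> (x (\<iota> k) j)" for n P
    proof -
      obtain V where V: "V \<in> cylinders" "V \<subseteq> W"
          "\<forall>k<n. \<forall>q\<in>V. if P k then F (\<iota> k) q < t / 4 else (t + 1) / 4 < F (\<iota> k) q"
        using \<iota> by blast
      then obtain q where q: "q \<in> V" unfolding cylinders_def using cylinder_self by blast
      have "\<forall>k<n. if P k then h (x (\<iota> k) j) (?p q) \<le> t / 4 else t / 4 + 1 / 4 \<le> h (x (\<iota> k) j) (?p q)"
      proof (intro allI impI)
        fix k assume "k < n"
        with V(3) q have "if P k then F (\<iota> k) q < t / 4 else (t + 1) / 4 < F (\<iota> k) q" by blast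
        thus "if P k then h (x (\<iota> k) j) (?p q) \<le> t / 4 else t / 4 + 1 / 4 \<le> h (x (\<iota> k) j) (?p q)"
          by (simp add: F_def add_divide_distrib split: if_splits)
      qed
      moreover have "q \<in> W0" using q V(2) W(2) by blast
      ultimately show ?thesis by (intro bexI[of _ "\<lambda>x. h x (?p q)"] imageI)
    qed
  qed (use M bound h_add h_scale principal_point_in in auto)
qed

end

theorem not_weakly_radon_nikodym_branch_space: "\<not> weakly_radon_nikodym branch_space"
proof
  assume "weakly_radon_nikodym branch_space"
  then obtain E :: "(nat \<Rightarrow> nat set set \<times> nat set set \<Rightarrow> real) set" and add zero scl nrm
    where K: "compact_space branch_space" and w: "wrn_witness branch_space E add zero scl nrm"
    unfolding weakly_radon_nikodym_def by blast
  obtain h where "represented_compact E add zero scl nrm branch_space h"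
    using wrn_witness_represented[OF K w] .
  then interpret represented_branch_space E add zero scl nrm h
    by (rule represented_branch_space.intro)
  show False using l1_embeds w unfolding wrn_witness_def by blast
qed

theorem theorem5p5:
  shows "\<exists>A :: nat set set.
           boolean_subalgebra A \<and> minimally_generated A \<and>
           separable_space (stone_space A) \<and> rosenthal_compact (stone_space A) \<and>
           \<not> weakly_radon_nikodym (stone_space A)"
  using branch_algebra_subalgebra minimally_generated_branch_algebra
    separable_space_stone_space[OF branch_algebra_subalgebra]
    rosenthal_compact_branch_algebra not_weakly_radon_nikodym_branch_space
  by blast

end
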